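(* Let $\iota : \mathscr{A}_K^{\mathbb{R}} \setminus K \to \mathsf{P}^1_K$ be the map sending a point $\mathcal{S}$ to the unique minimal Cauchy filter $\mathfrak{F} \in \mathsf{P}^1_K$ satisfying $B_{\mathfrak{F}} = B_{\mathcal{S}}$. Then: 1. The map $\iota$ extends to a uniformly continuous bijection from $(\mathscr{P}_K, \Delta)$ to the uniform space $\mathsf{P}^1_K$; this extension is still denoted by $\iota$. 2. For every open or irrational (resp. closed or irrational) ball $B$ of $\mathbb{P}^1_K$, the image under $\iota$ of the open (resp. closed) ball of $\mathscr{P}_K$ corresponding to $B$ is equal to the open (resp. closed) ball of $\mathsf{P}^1_K$ corresponding to $B$, that is, to $\widehat{B}$ (resp. $\overline{B}$).
   Context: Standing assumptions: $K$ is a field complete for an ultrametric absolute value $|\cdot|$, with infinite residue field and with value group $|K^*| = \{|z| : z \in K\setminus\{0\}\}$ not discrete. $\mathbb{P}^1_K = K \sqcup\{\infty\}$ is the projective line, with the topology of the chordal distance $\Delta([x:y],[x':y']) = \frac{|xy'-yx'|}{\max\{|x|,|y|\}\max\{|x'|,|y'|\}}$. Balls and affinoids. For $a\in K$ and $r\in|K^*|$, $\{|z-a|<r\}$ is an open ball of $K$ and $\{|z-a|\le r\}$ a closed ball of $K$; for $r>0$ with $r\notin|K^*|$ these two sets coincide and form an irrational ball of $K$. An open (resp. closed, irrational) ball of $\mathbb{P}^1_K$ is an open (resp. closed, irrational) ball of $K$ or the complement in $\mathbb{P}^1_K$ of a closed (resp. open, irrational) ball of $K$. An open affinoid is a finite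 intersection of open balls of $\mathbb{P}^1_K$ ($\mathbb{P}^1_K$ itself being the empty intersection). The space $\mathsf{P}^1_K$. Let $\mathfrak{C}$ be the set of finite covers of $\mathbb{P}^1_K$ by open affinoids. The sets containing some $V(C) = \bigcup_{Y\in C} Y\times Y$, $C\in\mathfrak{C}$, are the entourages of a uniform structure on $\mathbb{P}^1_K$ (compatible with its topology). A filter on $\mathbb{P}^1_K$ is Cauchy if for every entourage $V$ it contains a $V$-small set, i.e. a set $Y$ with $Y\times Y\subset V$. $\mathsf{P}^1_K$ is the Hausdorff completion: the set of Cauchy filters that are minimal for inclusion among Cauchy filters, with the uniform structure having as base the sets $\{(\mathfrak{F},\mathfrak{F}')\in \mathsf{P}^1_K\times \mathsf{P}^1_K : \mathfrak{F},\mathfrak{F}' \text{ contain a common } V\text{-small set}\}$, $V$ an entourage. $\mathbb{P}^1_K$ is identified with the dense subspace of convergent filters of $\mathsf{P}^1_K$ (a point corresponds to its neighbourhood filter). For $Y\subset\mathbb{P}^1_K$, $\widehat{Y}=\{\mathfrak{F}\in\mathsf{P}^1_K : Y\in\mathfrak{F}\}$ and $\overline{Y}$ is the closure of $Y$ in $\mathsf{P}^1_K$. For $B$ an open or irrational ball (resp. closed or irrational ball) of $\mathbb{P}^1_K$, $\widehat{B}$ (resp. $\overline{B}$) is called the open (resp. closed) ball of $\mathsf{P}^1_K$ corresponding to $B$. For a non-convergent $\mathfrak{F}\in\mathsf{P}^1_K$, $B_{\mathfrak{F}}$ is the intersection of all balls of $K$ that are elements of $\mathfrak{F}$; it is a closed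 ball of $K$, an irrational ball of $K$, or empty, and each closed or irrational ball of $K$ equals $B_{\mathfrak{F}}$ for exactly one non-convergent $\mathfrak{F}\in\mathsf{P}^1_K$. The tree $\mathscr{P}_K$. $\mathscr{A}_K^{\mathbb{R}}$ is the quotient of $K\times[0,+\infty)$ by $(x,r)\sim(x',r')$ iff $r=r'$ and $r\ge|x-x'|$; the class of $(x,r)$ is $[x,r]$, and $K$ is embedded by $x\mapsto[x,0]$. For $\mathcal{S}=[x,r]$, $B_{\mathcal{S}}=\{w\in K: |w-x|\le r\}$. The formula $\delta([x,r],[x',r'])=\max\{r,r',|x-x'|\}-\frac12(r+r')$ defines a distance on $\mathscr{A}_K^{\mathbb{R}}$; $\mathscr{A}_K$ is its completion. The functions $\operatorname{diam}([x,r])=r$, $|[x,r]|=\max\{|x|,r\}$, $\sup\{[x,r],[x',r']\}=\max\{r,r',|x-x'|\}$ extend continuously to $\mathscr{A}_K$ (resp. $\mathscr{A}_K\times\mathscr{A}_K$). On $\mathscr{A}_K$ one has the distance $$\Delta(\mathcal{S},\mathcal{S}')=\frac{\sup\{\mathcal{S},\mathcal{S}'\}}{\max\{1,|\mathcal{S}|\}\max\{1,|\mathcal{S}'|\}}-\frac12\frac{\operatorname{diam}(\mathcal{S})}{\max\{1,|\mathcal{S}|\}^2}-\frac12\frac{\operatorname{diam}(\mathcal{S}')}{\max\{1,|\mathcal{S}'|\}^2},$$ and its completion is $\mathscr{P}_K=\mathscr{A}_K\sqcup\{\infty\}$, with the extended distance still denoted $\Delta$, where $\Delta(\mathcal{S},\infty)=\frac{1}{\max\{1,|\mathcal{S}|\}}-\frac12\frac{\operatorname{diam}(\mathcal{S})}{\max\{1,|\mathcal{S}|\}^2}$;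 $\mathbb{P}^1_K=K\sqcup\{\infty\}\subset\mathscr{P}_K$. An open (resp. closed) ball of $\mathscr{A}_K$ is a set $\{\mathcal{S}\in\mathscr{A}_K:\sup\{x,\mathcal{S}\}<r\}$ (resp. $\le r$) with $x\in K$, $r>0$; an open (resp. closed) ball of $\mathscr{P}_K$ is an open (resp. closed) ball of $\mathscr{A}_K$ or the complement in $\mathscr{P}_K$ of a closed (resp. open) ball of $\mathscr{A}_K$. For each open or irrational (resp. closed or irrational) ball $B$ of $\mathbb{P}^1_K$ there is a unique open (resp. closed) ball $\mathscr{B}$ of $\mathscr{P}_K$ with $\mathscr{B}\cap\mathbb{P}^1_K=B$; it is the ball of $\mathscr{P}_K$ corresponding to $B$. *)

theory Defs
  imports "HOL-Analysis.Analysis"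
begin

section \<open>The valued field\<close>

definition value_group :: "('k::field \<Rightarrow> real) \<Rightarrow> real set" where
  "value_group av = av ` (UNIV - {0})"

text \<open>The residue field is the quotient of the valuation ring by its maximal ideal; only its
  cardinality matters, so it is taken as a plain set of cosets.\<close>

definition residue_field :: "('k::field \<Rightarrow> real) \<Rightarrow> 'k set set" where
  "residue_field av = {x. av x \<le> 1} // {(x, y). av x \<le> 1 \<and> av y \<le> 1 \<and> av (x - y) < 1}"

locale ultrametric_field =
  fixes av :: "'k::field \<Rightarrow> real"
  assumes av_nonneg: "0 \<le> av x"
    and av_eq_0_iff: "av x = 0 \<longleftrightarrow> x = 0"
    and av_mult: "av (x * y) = av x * av y"
    and av_add: "av (x + y) \<le> max (av x) (av y)"
    and complete: "Metric_space.mcomplete UNIV (\<lambda>x y. av (x - y))"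
    and infinite_residue_field: "infinite (residue_field av)"
    and value_group_not_discrete: "\<not> discrete (value_group av)"


section \<open>The projective line, its balls and open affinoids\<close>

text \<open>The projective line is \<^typ>\<open>'k option\<close>, where \<^term>\<open>None\<close> is the point at infinity.\<close>

fun P1_coords :: "'k::field option \<Rightarrow> 'k \<times> 'k" where
  "P1_coords (Some x) = (x, 1)"
| "P1_coords None = (1, 0)"

definition P1_dist :: "('k::field \<Rightarrow> real) \<Rightarrow> 'k option \<Rightarrow> 'k option \<Rightarrow> real" where
  "P1_dist av p q = (case (P1_coords p, P1_coords q) of ((x, y), (x', y')) \<Rightarrow>
     av (x * y' - y * x') / (max (av x) (av y) * max (av x') (av y')))"

definition P1_topology :: "('k::field \<Rightarrow> real) \<Rightarrow> 'k option topology" where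
  "P1_topology av = Metric_space.mtopology UNIV (P1_dist av)"

definition K_open_ball :: "('k::field \<Rightarrow> real) \<Rightarrow> 'k set \<Rightarrow> bool" where
  "K_open_ball av B \<longleftrightarrow> (\<exists>a. \<exists>r\<in>value_group av. B = {z. av (z - a) < r})"

definition K_closed_ball :: "('k::field \<Rightarrow> real) \<Rightarrow> 'k set \<Rightarrow> bool" where
  "K_closed_ball av B \<longleftrightarrow> (\<exists>a. \<exists>r\<in>value_group av. B = {z. av (z - a) \<le> r})"

definition K_irrational_ball :: "('k::field \<Rightarrow> real) \<Rightarrow> 'k set \<Rightarrow> bool" where
  "K_irrational_ball av B \<longleftrightarrow> (\<exists>a. \<exists>r>0. r \<notin> value_group av \<and> B = {z. av (z - a) \<le> r})"

definition K_ball :: "('k::field \<Rightarrow> real) \<Rightarrow> 'k set \<Rightarrow> bool" where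
  "K_ball av B \<longleftrightarrow> K_open_ball av B \<or> K_closed_ball av B \<or> K_irrational_ball av B"

definition P1_open_ball :: "('k::field \<Rightarrow> real) \<Rightarrow> 'k option set \<Rightarrow> bool" where
  "P1_open_ball av B \<longleftrightarrow>
     (\<exists>D. K_open_ball av D \<and> B = Some ` D) \<or> (\<exists>D. K_closed_ball av D \<and> B = - (Some ` D))"

definition P1_closed_ball :: "('k::field \<Rightarrow> real) \<Rightarrow> 'k option set \<Rightarrow> bool" where
  "P1_closed_ball av B \<longleftrightarrow>
     (\<exists>D. K_closed_ball av D \<and> B = Some ` D) \<or> (\<exists>D. K_open_ball av D \<and> B = - (Some ` D))"

definition P1_irrational_ball :: "('k::field \<Rightarrow> real) \<Rightarrow> 'k option set \<Rightarrow> bool" where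
  "P1_irrational_ball av B \<longleftrightarrow> (\<exists>D. K_irrational_ball av D \<and> (B = Some ` D \<or> B = - (Some ` D)))"

definition open_affinoid :: "('k::field \<Rightarrow> real) \<Rightarrow> 'k option set \<Rightarrow> bool" where
  "open_affinoid av Y \<longleftrightarrow> (\<exists>\<B>. finite \<B> \<and> (\<forall>B\<in>\<B>. P1_open_ball av B) \<and> Y = \<Inter>\<B>)"


section \<open>The uniform structure of the projective line\<close>

definition affinoid_covers :: "('k::field \<Rightarrow> real) \<Rightarrow> 'k option set set set" where
  "affinoid_covers av = {C. finite C \<and> (\<forall>Y\<in>C. open_affinoid av Y) \<and> \<Union>C = UNIV}"

definition cover_entourage :: "'a set set \<Rightarrow> ('a \<times> 'a) set" where
  "cover_entourage C = (\<Union>Y\<in>C. Y \<times> Y)"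

definition P1_uniformity :: "('k::field \<Rightarrow> real) \<Rightarrow> ('k option \<times> 'k option) set set" where
  "P1_uniformity av = {V. \<exists>C\<in>affinoid_covers av. cover_entourage C \<subseteq> V}"

text \<open>A filter in the sense of Bourbaki is a \<^typ>\<open>'a filter\<close> other than \<^term>\<open>bot\<close>.\<close>

definition filter_mem :: "'a set \<Rightarrow> 'a filter \<Rightarrow> bool" where
  "filter_mem Y F \<longleftrightarrow> eventually (\<lambda>z. z \<in> Y) F"

definition P1_cauchy :: "('k::field \<Rightarrow> real) \<Rightarrow> 'k option filter \<Rightarrow> bool" where
  "P1_cauchy av F \<longleftrightarrow> F \<noteq> bot \<and> (\<forall>V\<in>P1_uniformity av. \<exists>Y. filter_mem Y F \<and> Y \<times> Y \<subseteq> V)"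


section \<open>The Hausdorff completion of the projective line\<close>

text \<open>The order on \<^typ>\<open>'a filter\<close> is opposite to the inclusion of filters as sets of sets, so a
  filter that is minimal for inclusion is a maximal element here.\<close>

definition Phat :: "('k::field \<Rightarrow> real) \<Rightarrow> 'k option filter set" where
  "Phat av = {F. P1_cauchy av F \<and> (\<forall>G. P1_cauchy av G \<and> F \<le> G \<longrightarrow> G = F)}"

definition common_small :: "('k::field \<Rightarrow> real) \<Rightarrow> ('k option \<times> 'k option) set
    \<Rightarrow> ('k option filter \<times> 'k option filter) set" where
  "common_small av V =
     {(F, G) \<in> Phat av \<times> Phat av. \<exists>Y. filter_mem Y F \<and> filter_mem Y G \<and> Y \<times> Y \<subseteq> V}"

definition Phat_uniformity ::
    "('k::field \<Rightarrow> real) \<Rightarrow> ('k option filter \<times> 'k option filter) set set" where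
  "Phat_uniformity av =
     {W. W \<subseteq> Phat av \<times> Phat av \<and> (\<exists>V\<in>P1_uniformity av. common_small av V \<subseteq> W)}"

definition uniform_topology :: "'a set \<Rightarrow> ('a \<times> 'a) set set \<Rightarrow> 'a topology" where
  "uniform_topology X \<U> = topology (\<lambda>A. A \<subseteq> X \<and> (\<forall>x\<in>A. \<exists>E\<in>\<U>. E `` {x} \<subseteq> A))"

definition Phat_topology :: "('k::field \<Rightarrow> real) \<Rightarrow> 'k option filter topology" where
  "Phat_topology av = uniform_topology (Phat av) (Phat_uniformity av)"

definition P1_point :: "('k::field \<Rightarrow> real) \<Rightarrow> 'k option \<Rightarrow> 'k option filter" where
  "P1_point av z = nhdsin (P1_topology av) z"

definition P1_convergent :: "('k::field \<Rightarrow> real) \<Rightarrow> 'k option filter \<Rightarrow> bool" where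
  "P1_convergent av F \<longleftrightarrow> (\<exists>z. F \<le> nhdsin (P1_topology av) z)"

definition hat :: "('k::field \<Rightarrow> real) \<Rightarrow> 'k option set \<Rightarrow> 'k option filter set" where
  "hat av Y = {F \<in> Phat av. filter_mem Y F}"

definition P1_closure :: "('k::field \<Rightarrow> real) \<Rightarrow> 'k option set \<Rightarrow> 'k option filter set" where
  "P1_closure av Y = Phat_topology av closure_of (P1_point av ` Y)"

definition ball_of_filter :: "('k::field \<Rightarrow> real) \<Rightarrow> 'k option filter \<Rightarrow> 'k set" where
  "ball_of_filter av F = \<Inter>{B. K_ball av B \<and> filter_mem (Some ` B) F}"

lemma cover_entourage_Int:
  "cover_entourage {Y \<inter> Z |Y Z. Y \<in> C \<and> Z \<in> D} \<subseteq> cover_entourage C \<inter> cover_entourage D"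
  by (auto simp: cover_entourage_def)

lemma open_affinoid_Int:
  assumes "open_affinoid av Y" "open_affinoid av Z"
  shows "open_affinoid av (Y \<inter> Z)"
proof -
  from assms obtain \<B> \<C> where
    "finite \<B>" "\<forall>B\<in>\<B>. P1_open_ball av B" "Y = \<Inter>\<B>"
    "finite \<C>" "\<forall>B\<in>\<C>. P1_open_ball av B" "Z = \<Inter>\<C>"
    unfolding open_affinoid_def by metis
  then show ?thesis
    unfolding open_affinoid_def by (intro exI[of _ "\<B> \<union> \<C>"]) auto
qed

lemma affinoid_covers_Int:
  assumes C: "C \<in> affinoid_covers av" and D: "D \<in> affinoid_covers av"
  shows "{Y \<inter> Z |Y Z. Y \<in> C \<and> Z \<in> D} \<in> affinoid_covers av"
proof -
  have "{Y \<inter> Z |Y Z. Y \<in> C \<and> Z \<in> D} = (\<lambda>(Y, Z). Y \<inter> Z) ` (C \<times> D)" by auto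
  moreover have "finite (C \<times> D)"
    using C D by (simp add: affinoid_covers_def)
  ultimately have "finite {Y \<inter> Z |Y Z. Y \<in> C \<and> Z \<in> D}" by simp
  moreover have "\<Union>{Y \<inter> Z |Y Z. Y \<in> C \<and> Z \<in> D} = \<Union>C \<inter> \<Union>D" by auto
  ultimately show ?thesis
    using C D by (auto simp: affinoid_covers_def open_affinoid_Int)
qed

lemma P1_uniformity_Int:
  assumes "V \<in> P1_uniformity av" "W \<in> P1_uniformity av"
  shows "V \<inter> W \<in> P1_uniformity av"
proof -
  from assms obtain C D where "C \<in> affinoid_covers av" "cover_entourage C \<subseteq> V"
    "D \<in> affinoid_covers av" "cover_entourage D \<subseteq> W"
    unfolding P1_uniformity_def by blast
  then show ?thesis
    using affinoid_covers_Int[of C av D] cover_entourage_Int[of C D]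
    unfolding P1_uniformity_def by blast
qed

lemma Phat_uniformity_Int:
  assumes "V \<in> Phat_uniformity av" "W \<in> Phat_uniformity av"
  shows "V \<inter> W \<in> Phat_uniformity av"
proof -
  from assms obtain V' W' where V': "V' \<in> P1_uniformity av" "common_small av V' \<subseteq> V"
    and W': "W' \<in> P1_uniformity av" "common_small av W' \<subseteq> W"
    unfolding Phat_uniformity_def by blast
  have "common_small av (V' \<inter> W') \<subseteq> V \<inter> W"
    using V'(2) W'(2) unfolding common_small_def by blast
  moreover have "V \<inter> W \<subseteq> Phat av \<times> Phat av"
    using assms unfolding Phat_uniformity_def by blast
  ultimately show ?thesis
    using P1_uniformity_Int[OF V'(1) W'(1)] unfolding Phat_uniformity_def by blast
qed

lemma openin_uniform_topology:
  assumes "\<And>E E'. E \<in> \<U> \<Longrightarrow> E' \<in> \<U> \<Longrightarrow> E \<inter> E' \<in> \<U>"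
  shows "openin (uniform_topology X \<U>) A \<longleftrightarrow> A \<subseteq> X \<and> (\<forall>x\<in>A. \<exists>E\<in>\<U>. E `` {x} \<subseteq> A)"
proof -
  have "istopology (\<lambda>A. A \<subseteq> X \<and> (\<forall>x\<in>A. \<exists>E\<in>\<U>. E `` {x} \<subseteq> A))"
    unfolding istopology_def
  proof (intro conjI allI impI; (elim conjE)?)
    fix S T
    assume "S \<subseteq> X" "T \<subseteq> X" and S: "\<forall>x\<in>S. \<exists>E\<in>\<U>. E `` {x} \<subseteq> S"
      and T: "\<forall>x\<in>T. \<exists>E\<in>\<U>. E `` {x} \<subseteq> T"
    then show "S \<inter> T \<subseteq> X" by blast
    show "\<forall>x\<in>S \<inter> T. \<exists>E\<in>\<U>. E `` {x} \<subseteq> S \<inter> T"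
    proof
      fix x assume "x \<in> S \<inter> T"
      then obtain E E' where "E \<in> \<U>" "E `` {x} \<subseteq> S" "E' \<in> \<U>" "E' `` {x} \<subseteq> T"
        using S T by blast
      then show "\<exists>E\<in>\<U>. E `` {x} \<subseteq> S \<inter> T"
        using assms[of E E'] by blast
    qed
  next
    fix \<K> assume *: "\<forall>S\<in>\<K>. S \<subseteq> X \<and> (\<forall>x\<in>S. \<exists>E\<in>\<U>. E `` {x} \<subseteq> S)"
    then show "\<Union>\<K> \<subseteq> X" by blast
    from * show "\<forall>x\<in>\<Union>\<K>. \<exists>E\<in>\<U>. E `` {x} \<subseteq> \<Union>\<K>"
      by (meson Union_iff Union_upper order_trans)
  qed
  then show ?thesis
    by (simp add: uniform_topology_def topology_inverse')
qed

lemma openin_Phat_topology: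
  "openin (Phat_topology av) A \<longleftrightarrow> A \<subseteq> Phat av \<and> (\<forall>F\<in>A. \<exists>E\<in>Phat_uniformity av. E `` {F} \<subseteq> A)"
  unfolding Phat_topology_def by (rule openin_uniform_topology) (rule Phat_uniformity_Int)


section \<open>Completion of a metric space by Cauchy sequences\<close>

definition cauchy_equiv :: "'a set \<Rightarrow> ('a \<Rightarrow> 'a \<Rightarrow> real) \<Rightarrow> ((nat \<Rightarrow> 'a) \<times> (nat \<Rightarrow> 'a)) set" where
  "cauchy_equiv M d = {(s, t). Metric_space.MCauchy M d s \<and> Metric_space.MCauchy M d t
     \<and> (\<lambda>n. d (s n) (t n)) \<longlonglongrightarrow> 0}"

definition metric_completion :: "'a set \<Rightarrow> ('a \<Rightarrow> 'a \<Rightarrow> real) \<Rightarrow> (nat \<Rightarrow> 'a) set set" where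
  "metric_completion M d = {s. Metric_space.MCauchy M d s} // cauchy_equiv M d"

definition completion_embed :: "'a set \<Rightarrow> ('a \<Rightarrow> 'a \<Rightarrow> real) \<Rightarrow> 'a \<Rightarrow> (nat \<Rightarrow> 'a) set" where
  "completion_embed M d x = cauchy_equiv M d `` {\<lambda>_. x}"

text \<open>Extension by continuity of real functions of one and of two variables to the completion.\<close>

definition extend1 :: "('a \<Rightarrow> real) \<Rightarrow> (nat \<Rightarrow> 'a) set \<Rightarrow> real" where
  "extend1 f c = (THE l. \<forall>s\<in>c. (\<lambda>n. f (s n)) \<longlonglongrightarrow> l)"

definition extend2 ::
    "('a \<Rightarrow> 'a \<Rightarrow> real) \<Rightarrow> (nat \<Rightarrow> 'a) set \<Rightarrow> (nat \<Rightarrow> 'a) set \<Rightarrow> real" where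
  "extend2 f c c' = (THE l. \<forall>s\<in>c. \<forall>t\<in>c'. (\<lambda>n. f (s n) (t n)) \<longlonglongrightarrow> l)"


section \<open>The real tree of balls and its completion\<close>

type_synonym 'k disc = "('k \<times> real) set"
type_synonym 'k tree_point = "(nat \<Rightarrow> 'k disc) set"

definition disc_rel :: "('k::field \<Rightarrow> real) \<Rightarrow> (('k \<times> real) \<times> ('k \<times> real)) set" where
  "disc_rel av = {((x, r), (x', r')). 0 \<le> r \<and> r = r' \<and> av (x - x') \<le> r}"

definition disc :: "('k::field \<Rightarrow> real) \<Rightarrow> 'k \<Rightarrow> real \<Rightarrow> 'k disc" where
  "disc av x r = disc_rel av `` {(x, r)}"

definition AKR :: "('k::field \<Rightarrow> real) \<Rightarrow> 'k disc set" where
  "AKR av = (UNIV \<times> {0..}) // disc_rel av"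

text \<open>The functions below do not depend on the representatives, see the lemmas that follow.\<close>

definition AKR_ball :: "('k::field \<Rightarrow> real) \<Rightarrow> 'k disc \<Rightarrow> 'k set" where
  "AKR_ball av S = {w. \<exists>(x, r)\<in>S. av (w - x) \<le> r}"

definition AKR_diam :: "'k disc \<Rightarrow> real" where
  "AKR_diam S = (THE m. \<exists>(x, r)\<in>S. m = r)"

definition AKR_abs :: "('k::field \<Rightarrow> real) \<Rightarrow> 'k disc \<Rightarrow> real" where
  "AKR_abs av S = (THE m. \<exists>(x, r)\<in>S. m = max (av x) r)"

definition AKR_sup :: "('k::field \<Rightarrow> real) \<Rightarrow> 'k disc \<Rightarrow> 'k disc \<Rightarrow> real" where
  "AKR_sup av S S' = (THE m. \<exists>(x, r)\<in>S. \<exists>(x', r')\<in>S'. m = max (max r r') (av (x - x')))"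

text \<open>The locale \<^locale>\<open>Metric_space\<close> asks for nonnegativity and symmetry of the distance on
  the whole type, hence the value 0 off the carrier.\<close>

definition AKR_dist :: "('k::field \<Rightarrow> real) \<Rightarrow> 'k disc \<Rightarrow> 'k disc \<Rightarrow> real" where
  "AKR_dist av S S' = (if S \<in> AKR av \<and> S' \<in> AKR av
     then AKR_sup av S S' - 1 / 2 * (AKR_diam S + AKR_diam S') else 0)"

definition AK :: "('k::field \<Rightarrow> real) \<Rightarrow> 'k tree_point set" where
  "AK av = metric_completion (AKR av) (AKR_dist av)"

definition AK_embed :: "('k::field \<Rightarrow> real) \<Rightarrow> 'k disc \<Rightarrow> 'k tree_point" where
  "AK_embed av = completion_embed (AKR av) (AKR_dist av)"

definition AK_diam :: "'k tree_point \<Rightarrow> real" where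
  "AK_diam = extend1 AKR_diam"

definition AK_abs :: "('k::field \<Rightarrow> real) \<Rightarrow> 'k tree_point \<Rightarrow> real" where
  "AK_abs av = extend1 (AKR_abs av)"

definition AK_sup :: "('k::field \<Rightarrow> real) \<Rightarrow> 'k tree_point \<Rightarrow> 'k tree_point \<Rightarrow> real" where
  "AK_sup av = extend2 (AKR_sup av)"

context ultrametric_field
begin

lemma av_1: "av 1 = 1"
  using av_mult[of 1 1] av_eq_0_iff[of 1] by simp

lemma av_minus: "av (- x) = av x"
proof -
  have "(av (- 1))\<^sup>2 = 1\<^sup>2"
    using av_mult[of "-1" "-1"] av_1 by (simp add: power2_eq_square)
  then have "av (- 1) = 1"
    using power2_eq_imp_eq[of "av (- 1)" 1] av_nonneg by simp
  then show ?thesis using av_mult[of "-1" x] by simp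
qed

lemma av_diff_commute: "av (x - y) = av (y - x)"
  using av_minus[of "x - y"] by simp

lemma av_triangle: "av (x - z) \<le> max (av (x - y)) (av (y - z))"
  using av_add[of "x - y" "y - z"] by simp

lemma equiv_disc_rel: "equiv (UNIV \<times> {0..}) (disc_rel av)"
proof (rule equivI)
  show "disc_rel av \<subseteq> (UNIV \<times> {0..}) \<times> (UNIV \<times> {0..})"
    by (auto simp: disc_rel_def)
  show "refl_on (UNIV \<times> {0..}) (disc_rel av)"
    by (auto simp: disc_rel_def refl_on_def av_eq_0_iff[THEN iffD2])
  show "sym (disc_rel av)"
    by (auto simp: disc_rel_def sym_def av_diff_commute)
  show "trans (disc_rel av)"
    unfolding disc_rel_def by (auto intro!: transI intro: order_trans[OF av_triangle])
qed

lemma mem_disc: "0 \<le> r \<Longrightarrow> p \<in> disc av x r \<longleftrightarrow> (\<exists>y. p = (y, r) \<and> av (y - x) \<le> r)"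
  by (cases p) (auto simp: disc_def disc_rel_def av_diff_commute)

lemma av_0 [simp]: "av 0 = 0"
  by (simp add: av_eq_0_iff)

lemma disc_in_AKR: "0 \<le> r \<Longrightarrow> disc av x r \<in> AKR av"
  by (auto simp: AKR_def quotient_def disc_def)

lemma AKR_cases:
  assumes "S \<in> AKR av"
  obtains x r where "0 \<le> r" "S = disc av x r"
  using assms by (auto simp: AKR_def quotient_def disc_def)

lemma self_mem_disc: "0 \<le> r \<Longrightarrow> (x, r) \<in> disc av x r"
  by (simp add: mem_disc)

lemma AKR_ball_disc:
  assumes r: "0 \<le> r"
  shows "AKR_ball av (disc av x r) = {w. av (w - x) \<le> r}"
proof -
  have "av (w - x) \<le> r" if "av (w - y) \<le> r" "av (y - x) \<le> r" for w y
    using av_triangle[of w x y] that by simp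
  then show ?thesis
    using r self_mem_disc[OF r, of x] by (force simp: AKR_ball_def mem_disc)
qed

lemma AKR_diam_disc:
  assumes r: "0 \<le> r"
  shows "AKR_diam (disc av x r) = r"
  unfolding AKR_diam_def
proof (rule the_equality)
  show "\<exists>(y, s)\<in>disc av x r. r = s"
    using self_mem_disc[OF r, of x] by blast
qed (use r in \<open>auto simp: mem_disc\<close>)

lemma AKR_abs_disc:
  assumes r: "0 \<le> r"
  shows "AKR_abs av (disc av x r) = max (av x) r"
proof -
  have *: "max (av y) r = max (av x) r" if "av (y - x) \<le> r" for y
    using that av_triangle[of y 0 x] av_triangle[of x 0 y] av_diff_commute[of x y] by auto
  show ?thesis
    unfolding AKR_abs_def
  proof (rule the_equality)
    show "\<exists>(y, s)\<in>disc av x r. max (av x) r = max (av y) s"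
      using self_mem_disc[OF r, of x] by blast
    fix m assume "\<exists>(y, s)\<in>disc av x r. m = max (av y) s"
    then obtain y where "av (y - x) \<le> r" "m = max (av y) r"
      using r by (auto simp: mem_disc)
    then show "m = max (av x) r" using *[of y] by simp
  qed
qed

lemma AKR_sup_disc:
  assumes r: "0 \<le> r" "0 \<le> r'"
  shows "AKR_sup av (disc av x r) (disc av x' r') = max (max r r') (av (x - x'))"
proof -
  have *: "max (max r r') (av (y - y')) = max (max r r') (av (x - x'))"
    if "av (y - x) \<le> r" "av (y' - x') \<le> r'" for y y'
    using that av_triangle[of y y' x] av_triangle[of x y' x'] av_triangle[of x x' y]
      av_triangle[of y x' y'] av_diff_commute[of x y] av_diff_commute[of x' y'] by linarith
  show ?thesis
    unfolding AKR_sup_def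
  proof (rule the_equality)
    show "\<exists>(y, s)\<in>disc av x r. \<exists>(y', s')\<in>disc av x' r'.
        max (max r r') (av (x - x')) = max (max s s') (av (y - y'))"
      using self_mem_disc[OF r(1), of x] self_mem_disc[OF r(2), of x'] by blast
    fix m assume "\<exists>(y, s)\<in>disc av x r. \<exists>(y', s')\<in>disc av x' r'. m = max (max s s') (av (y - y'))"
    then obtain y y' where "av (y - x) \<le> r" "av (y' - x') \<le> r'" "m = max (max r r') (av (y - y'))"
      using r by (auto simp: mem_disc)
    then show "m = max (max r r') (av (x - x'))" using *[of y y'] by simp
  qed
qed

lemma AKR_dist_disc:
  assumes "0 \<le> r" "0 \<le> r'"
  shows "AKR_dist av (disc av x r) (disc av x' r') = max (max r r') (av (x - x')) - 1 / 2 * (r + r')"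
  using assms by (simp add: AKR_dist_def AKR_sup_disc AKR_diam_disc disc_in_AKR)

lemma disc_eq_iff:
  assumes "0 \<le> r" "0 \<le> r'"
  shows "disc av x r = disc av x' r' \<longleftrightarrow> r = r' \<and> av (x - x') \<le> r"
proof -
  have "disc av x r = disc av x' r' \<longleftrightarrow> ((x, r), (x', r')) \<in> disc_rel av"
    unfolding disc_def using assms by (intro eq_equiv_class_iff[OF equiv_disc_rel]) auto
  then show ?thesis using assms by (auto simp: disc_rel_def)
qed

lemma Metric_space_AKR: "Metric_space (AKR av) (AKR_dist av)"
proof
  fix S T :: "'k disc"
  show "0 \<le> AKR_dist av S T"
  proof (cases "S \<in> AKR av \<and> T \<in> AKR av")
    case True
    then obtain x r y s where "0 \<le> r" "S = disc av x r" "0 \<le> s" "T = disc av y s"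
      by (metis AKR_cases)
    then show ?thesis by (auto simp: AKR_dist_disc)
  qed (auto simp: AKR_dist_def)
  show "AKR_dist av S T = AKR_dist av T S"
  proof (cases "S \<in> AKR av \<and> T \<in> AKR av")
    case True
    then obtain x r y s where "0 \<le> r" "S = disc av x r" "0 \<le> s" "T = disc av y s"
      by (metis AKR_cases)
    then show ?thesis by (simp add: AKR_dist_disc av_diff_commute[of x y] max.commute)
  qed (auto simp: AKR_dist_def)
next
  fix S T assume "S \<in> AKR av" "T \<in> AKR av"
  then obtain x r y s where *: "0 \<le> r" "S = disc av x r" "0 \<le> s" "T = disc av y s"
    by (metis AKR_cases)
  have "max (max r s) (av (x - y)) - 1 / 2 * (r + s) = 0 \<longleftrightarrow> r = s \<and> av (x - y) \<le> r"
    by (auto simp: max_def field_simps)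
  then show "AKR_dist av S T = 0 \<longleftrightarrow> S = T"
    using * by (simp add: AKR_dist_disc disc_eq_iff)
next
  fix S T U assume "S \<in> AKR av" "T \<in> AKR av" "U \<in> AKR av"
  then obtain x r y s z t where *: "0 \<le> r" "S = disc av x r" "0 \<le> s" "T = disc av y s"
      "0 \<le> t" "U = disc av z t"
    by (metis AKR_cases)
  have "max (max r t) (av (x - z)) + s
      \<le> max (max r s) (av (x - y)) + max (max s t) (av (y - z))"
    using av_triangle[of x z y] by linarith
  then show "AKR_dist av S U \<le> AKR_dist av S T + AKR_dist av T U"
    using * by (simp add: AKR_dist_disc field_simps)
qed

end


section \<open>The complete tree and its balls\<close>

text \<open>A point of the complete tree is an element of \<^typ>\<open>'k tree_point option\<close>, where
  \<^term>\<open>None\<close> is the point at infinity.\<close>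

definition PK :: "('k::field \<Rightarrow> real) \<Rightarrow> 'k tree_point option set" where
  "PK av = insert None (Some ` AK av)"

fun PK_dist :: "('k::field \<Rightarrow> real) \<Rightarrow> 'k tree_point option \<Rightarrow> 'k tree_point option \<Rightarrow> real" where
  "PK_dist av (Some S) (Some S') =
     AK_sup av S S' / (max 1 (AK_abs av S) * max 1 (AK_abs av S'))
     - 1 / 2 * (AK_diam S / (max 1 (AK_abs av S))\<^sup>2)
     - 1 / 2 * (AK_diam S' / (max 1 (AK_abs av S'))\<^sup>2)"
| "PK_dist av (Some S) None =
     1 / max 1 (AK_abs av S) - 1 / 2 * (AK_diam S / (max 1 (AK_abs av S))\<^sup>2)"
| "PK_dist av None (Some S) =
     1 / max 1 (AK_abs av S) - 1 / 2 * (AK_diam S / (max 1 (AK_abs av S))\<^sup>2)"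
| "PK_dist av None None = 0"

definition K_embed :: "('k::field \<Rightarrow> real) \<Rightarrow> 'k \<Rightarrow> 'k tree_point" where
  "K_embed av x = AK_embed av (disc av x 0)"

definition P1_embed :: "('k::field \<Rightarrow> real) \<Rightarrow> 'k option \<Rightarrow> 'k tree_point option" where
  "P1_embed av = map_option (K_embed av)"

definition AK_open_ball :: "('k::field \<Rightarrow> real) \<Rightarrow> 'k tree_point set \<Rightarrow> bool" where
  "AK_open_ball av \<D> \<longleftrightarrow> (\<exists>x. \<exists>r>0. \<D> = {S \<in> AK av. AK_sup av (K_embed av x) S < r})"

definition AK_closed_ball :: "('k::field \<Rightarrow> real) \<Rightarrow> 'k tree_point set \<Rightarrow> bool" where
  "AK_closed_ball av \<D> \<longleftrightarrow> (\<exists>x. \<exists>r>0. \<D> = {S \<in> AK av. AK_sup av (K_embed av x) S \<le> r})"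

definition PK_open_ball :: "('k::field \<Rightarrow> real) \<Rightarrow> 'k tree_point option set \<Rightarrow> bool" where
  "PK_open_ball av \<B> \<longleftrightarrow> (\<exists>\<D>. AK_open_ball av \<D> \<and> \<B> = Some ` \<D>)
     \<or> (\<exists>\<D>. AK_closed_ball av \<D> \<and> \<B> = PK av - Some ` \<D>)"

definition PK_closed_ball :: "('k::field \<Rightarrow> real) \<Rightarrow> 'k tree_point option set \<Rightarrow> bool" where
  "PK_closed_ball av \<B> \<longleftrightarrow> (\<exists>\<D>. AK_closed_ball av \<D> \<and> \<B> = Some ` \<D>)
     \<or> (\<exists>\<D>. AK_open_ball av \<D> \<and> \<B> = PK av - Some ` \<D>)"

text \<open>The ball of the tree whose trace on the projective line is \<^term>\<open>B\<close>.\<close>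

definition corr_open_ball :: "('k::field \<Rightarrow> real) \<Rightarrow> 'k option set \<Rightarrow> 'k tree_point option set" where
  "corr_open_ball av B = (THE \<B>. PK_open_ball av \<B> \<and> P1_embed av -` \<B> = B)"

definition corr_closed_ball :: "('k::field \<Rightarrow> real) \<Rightarrow> 'k option set \<Rightarrow> 'k tree_point option set" where
  "corr_closed_ball av B = (THE \<B>. PK_closed_ball av \<B> \<and> P1_embed av -` \<B> = B)"


section \<open>The map from the tree to the completion of the projective line\<close>

definition iota :: "('k::field \<Rightarrow> real) \<Rightarrow> 'k disc \<Rightarrow> 'k option filter" where
  "iota av S =
     (THE F. F \<in> Phat av \<and> \<not> P1_convergent av F \<and> ball_of_filter av F = AKR_ball av S)"

definition uniformly_continuous_into ::
    "'a set \<Rightarrow> ('a \<Rightarrow> 'a \<Rightarrow> real) \<Rightarrow> ('b \<times> 'b) set set \<Rightarrow> ('a \<Rightarrow> 'b) \<Rightarrow> bool" where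
  "uniformly_continuous_into M d \<U> f \<longleftrightarrow>
     (\<forall>E\<in>\<U>. \<exists>e>0. \<forall>x\<in>M. \<forall>y\<in>M. d x y < e \<longrightarrow> (f x, f y) \<in> E)"

end

theory Submission
  imports Defs
begin

text \<open>
  A point \<open>S\<close> of the tree is encoded by the function \<open>\<phi>(c) = sup{c, S}\<close> on \<open>K\<close>, which extends
  \<open>c \<mapsto> |z - c|\<close> from points \<open>z\<close> of \<open>K\<close>, and the point at infinity by the constant \<open>\<infinity>\<close>. A Cauchy filter
  has such a function too: two-set covers by balls \<open>|z - c| < r\<close> and \<open>|z - c| > s\<close> with \<open>s < r\<close> force
  \<open>|z - c|\<close> to have a limit along it, in \<open>[0, \<infinity>]\<close>. The map \<open>\<iota>\<close> sends a point of the tree to the coarsest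
  filter along which \<open>|z - c|\<close> tends to \<open>\<phi>(c)\<close> for all \<open>c\<close>, the constant \<open>tree_filter\<close> below. Four
  facts carry the proof.

  (1) The functions occurring as limits, when finite, satisfy the two ultrametric inequalities
  between \<open>\<phi>(a)\<close>, \<open>\<phi>(b)\<close> and \<open>|a - b|\<close>, and every function satisfying these comes from exactly one point
  of the tree: the discs with centre \<open>a\<close> and radius \<open>\<phi>(a)\<close> converge to it when \<open>\<phi>(a)\<close> tends to
  \<open>inf \<phi>\<close> (lemmas \<open>AK_point_of_distances\<close> and \<open>AK_eq_if_sup_K_eq\<close>).

  (2) Since the value group is dense and the residue field infinite, every finite set of conditions
  imposed by \<open>\<phi>\<close> can be met by points of \<open>K\<close>, up to small errors of a chosen sign (\<open>approx_above\<close>,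
  \<open>approx_below\<close>). Hence a ball \<open>|z - a| < r\<close> belongs to the filter if and only if \<open>\<phi>(a) < r\<close>, and
  likewise for \<open>>\<close>: a ball of the tree is the set of points whose filter contains the trace of the
  ball. This gives the second part of the theorem for open balls, and for closed balls by passing to
  complements.

  (3) Finite families of closed balls of the projective line have the Helly property
  (\<open>closed_balls_Helly\<close>; here the infinite residue field matters again), and two disjoint closed
  balls are a positive distance apart in the tree (\<open>disjoint_closed_balls_separated\<close>).

  (4) Together these provide a Lebesgue number for every finite cover by open affinoids: two points of
  the tree that are close enough have a common member of the cover in their filters
  (\<open>affinoid_cover_Lebesgue_number\<close>). This is uniform continuity, and for two equal points it says
  that the filter of a point is Cauchy.

  By (1), (4) and the existence of limits, every Cauchy filter refines the filter of a unique point of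
  the tree, so the minimal Cauchy filters are exactly these filters.
\<close>

context ultrametric_field
begin

section \<open>The value group and points in general position\<close>

lemma value_group_iff: "r \<in> value_group av \<longleftrightarrow> (\<exists>u. u \<noteq> 0 \<and> av u = r)"
  by (auto simp: value_group_def)

lemma value_group_pos: "r \<in> value_group av \<Longrightarrow> 0 < r"
  using av_nonneg av_eq_0_iff by (force simp: value_group_iff less_le)

lemma av_inverse: "av (inverse u) = inverse (av u)"
proof (cases "u = 0")
  case False
  then have "av u * av (inverse u) = 1"
    using av_mult[of u "inverse u"] av_1 by simp
  then show ?thesis by (simp add: inverse_unique)
qed simp

lemma av_divide: "av (x / y) = av x / av y"
  by (simp add: divide_inverse av_mult av_inverse)

lemma av_power: "av (x ^ n) = av x ^ n"
  by (induction n) (simp_all add: av_1 av_mult)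

lemma av_power_int: "av (x powi k) = av x powi k"
  by (simp add: power_int_def av_power av_inverse)

text \<open>Some value is not isolated, so quotients of distinct values give a value \<open>\<gamma> > 1\<close> arbitrarily
  close to \<open>1\<close>; its powers then meet every interval.\<close>

lemma value_group_dense:
  assumes "0 \<le> x" "x < y"
  shows "\<exists>r\<in>value_group av. x < r \<and> r < y"
proof -
  define x' where "x' = max x (y / 2)"
  have x': "0 < x'" "x' < y" "x \<le> x'"
    using assms by (auto simp: x'_def)
  define q where "q = y / x'"
  have q: "1 < q" using x' by (simp add: q_def)
  obtain v where v: "v \<in> value_group av"
    and acc: "\<And>e. e > 0 \<Longrightarrow> \<exists>w\<in>value_group av. w \<noteq> v \<and> dist v w < e"
    using value_group_not_discrete by (auto simp: discrete_def isolated_in_dist_Ex_iff) metis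
  have vpos: "0 < v" using v value_group_pos by blast
  define e where "e = v * (1 - 1 / q)"
  have "e > 0" using vpos q by (simp add: e_def)
  with acc obtain w where w: "w \<in> value_group av" "w \<noteq> v" "dist v w < e" by blast
  have wpos: "0 < w" using w(1) value_group_pos by blast
  have *: "v < q * w" "w < q * v"
  proof -
    have "v - w < v * (1 - 1 / q)" using w(3) by (simp add: dist_real_def e_def abs_if split: if_splits)
    then have "v / q < w" by (simp add: algebra_simps)
    then show "v < q * w" using q by (simp add: field_simps)
    have "w - v < v * (1 - 1 / q)" using w(3) by (simp add: dist_real_def e_def abs_if split: if_splits)
    moreover have "1 - 1 / q \<le> q - 1"
      using q sum_squares_ge_zero[of "q - 1" 0] by (simp add: field_simps power2_eq_square)
    then have "v * (1 - 1 / q) \<le> v * (q - 1)"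
      using vpos by (intro mult_left_mono) auto
    ultimately show "w < q * v" by (simp add: algebra_simps)
  qed
  have "\<exists>g\<in>value_group av. 1 < g \<and> g < q"
  proof -
    obtain a b where ab: "a \<noteq> 0" "av a = v" "b \<noteq> 0" "av b = w"
      using v w(1) by (auto simp: value_group_iff)
    show ?thesis
    proof (cases "v < w")
      case True
      have "b / a \<noteq> 0" "av (b / a) = w / v" using ab by (auto simp: av_divide)
      moreover have "1 < w / v" "w / v < q" using True * vpos by (auto simp: field_simps)
      ultimately show ?thesis by (auto simp: value_group_iff intro!: bexI[of _ "w / v"] exI[of _ "b / a"])
    next
      case False
      have "a / b \<noteq> 0" "av (a / b) = v / w" using ab by (auto simp: av_divide)
      moreover have "1 < v / w" "v / w < q" using False w(2) * wpos by (auto simp: field_simps)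
      ultimately show ?thesis by (auto simp: value_group_iff intro!: bexI[of _ "v / w"] exI[of _ "a / b"])
    qed
  qed
  then obtain u where u: "u \<noteq> 0" "1 < av u" "av u < q"
    by (auto simp: value_group_iff)
  define k where "k = \<lfloor>log (av u) x'\<rfloor> + 1"
  have pk: "av u powr (real_of_int k) = av u powi k"
    using u by (simp add: powr_real_of_int')
  have "log (av u) x' < k" by (simp add: k_def)
  then have "x' < av u powi k"
    using u x' pk by (simp add: log_less_iff)
  moreover have "av u powi k < y"
  proof -
    have "k - 1 \<le> log (av u) x'" by (simp add: k_def)
    then have "av u powr (k - 1) \<le> x'" using u x' by (simp add: le_log_iff)
    then have "av u powr k \<le> av u * x'"
      using u powr_add[of "av u" "k - 1" 1] by (simp add: mult.commute)
    also have "\<dots> < q * x'" using u x' by simp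
    also have "\<dots> = y" using x' by (simp add: q_def)
    finally show ?thesis using pk by simp
  qed
  moreover have "av u powi k \<in> value_group av"
    using u(1) av_power_int[of u k] by (auto simp: value_group_iff intro!: exI[of _ "u powi k"])
  ultimately show ?thesis using x'(3) by force
qed

text \<open>The translates of \<open>a\<close> by elements of value at most \<open>s\<close> are, after scaling, the elements of the
  valuation ring; a residue class that contains none of the finitely many points to be avoided
  supplies \<open>z\<close>.\<close>

lemma generic_point:
  assumes s: "s \<in> value_group av" and X: "finite X"
  shows "\<exists>z. av (z - a) \<le> s \<and> (\<forall>b\<in>X. max s (av (a - b)) \<le> av (z - b))"
proof -
  obtain u where u: "u \<noteq> 0" "av u = s" using s by (auto simp: value_group_iff)
  have spos: "0 < s" using s value_group_pos by blast
  define rel where "rel = {(x, y). av x \<le> 1 \<and> av y \<le> 1 \<and> av (x - y) < 1}"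
  have "finite ((\<lambda>b. rel `` {(b - a) / u}) ` X)" using X by simp
  moreover have "infinite ({x. av x \<le> 1} // rel)"
    using infinite_residue_field by (simp add: residue_field_def rel_def)
  ultimately obtain q where "q \<in> {x. av x \<le> 1} // rel" "q \<notin> (\<lambda>b. rel `` {(b - a) / u}) ` X"
    by (meson finite_subset subsetI)
  then obtain w where w: "av w \<le> 1" "rel `` {w} \<notin> (\<lambda>b. rel `` {(b - a) / u}) ` X"
    by (auto elim!: quotientE)
  define z where "z = a + u * w"
  have za: "av (z - a) \<le> s"
    using w(1) spos by (simp add: z_def av_mult u mult_left_le)
  moreover have "max s (av (a - b)) \<le> av (z - b)" if b: "b \<in> X" for b
  proof (cases "av (b - a) \<le> s")
    case True
    define \<beta> where "\<beta> = (b - a) / u"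
    have \<beta>: "av \<beta> \<le> 1" using True u spos by (simp add: \<beta>_def av_divide)
    have "\<not> av (w - \<beta>) < 1"
    proof
      assume lt: "av (w - \<beta>) < 1"
      have "av (w - y) < 1 \<longleftrightarrow> av (\<beta> - y) < 1" for y
        using lt av_triangle[of w y \<beta>] av_triangle[of \<beta> y w] av_diff_commute[of w \<beta>] by auto
      then have "rel `` {w} = rel `` {\<beta>}"
        using w(1) \<beta> by (auto simp: rel_def)
      then show False using w(2) b by (auto simp: \<beta>_def)
    qed
    moreover have "z - b = u * (w - \<beta>)"
      using u by (simp add: z_def \<beta>_def field_simps)
    ultimately have "s \<le> av (z - b)"
      using spos by (simp add: av_mult u)
    then show ?thesis using True av_diff_commute[of a b] by simp
  next
    case False
    then show ?thesis
      using za av_triangle[of a b z] av_diff_commute[of a b] av_diff_commute[of a z] by auto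
  qed
  ultimately show ?thesis by blast
qed

section \<open>The supremum on the complete tree\<close>

interpretation AKR: Metric_space "AKR av" "AKR_dist av"
  by (rule Metric_space_AKR)

lemma AKR_sup_nonneg: "S \<in> AKR av \<Longrightarrow> T \<in> AKR av \<Longrightarrow> 0 \<le> AKR_sup av S T"
  by (elim AKR_cases) (simp add: AKR_sup_disc)

lemma AKR_sup_commute: "S \<in> AKR av \<Longrightarrow> T \<in> AKR av \<Longrightarrow> AKR_sup av S T = AKR_sup av T S"
  by (elim AKR_cases) (simp add: AKR_sup_disc max.commute av_diff_commute)

lemma AKR_sup_ultra:
  "S \<in> AKR av \<Longrightarrow> T \<in> AKR av \<Longrightarrow> U \<in> AKR av \<Longrightarrow>
    AKR_sup av S U \<le> max (AKR_sup av S T) (AKR_sup av T U)"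
proof (elim AKR_cases)
  fix x r y s z t
  assume *: "0 \<le> r" "S = disc av x r" "0 \<le> s" "T = disc av y s" "0 \<le> t" "U = disc av z t"
  show "AKR_sup av S U \<le> max (AKR_sup av S T) (AKR_sup av T U)"
    using av_triangle[of x z y] * by (simp add: AKR_sup_disc) linarith
qed

lemma AKR_diam_eq_sup: "S \<in> AKR av \<Longrightarrow> AKR_diam S = AKR_sup av S S"
  by (elim AKR_cases) (simp add: AKR_sup_disc AKR_diam_disc)

lemma AKR_abs_eq_sup: "S \<in> AKR av \<Longrightarrow> AKR_abs av S = AKR_sup av (disc av 0 0) S"
  by (elim AKR_cases) (simp add: AKR_sup_disc AKR_abs_disc av_minus max.commute)

lemma AKR_dist_eq_sup:
  "S \<in> AKR av \<Longrightarrow> T \<in> AKR av \<Longrightarrow>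
    AKR_dist av S T = AKR_sup av S T - (AKR_sup av S S + AKR_sup av T T) / 2"
  by (simp add: AKR_dist_def AKR_diam_eq_sup)

lemma AKR_sup_self_le: "S \<in> AKR av \<Longrightarrow> T \<in> AKR av \<Longrightarrow> AKR_sup av S S \<le> AKR_sup av S T"
  using AKR_sup_ultra[of S T S] AKR_sup_commute[of S T] by simp

text \<open>Twice the distance is the sum of the excesses of the supremum over the two diameters, and the
  supremum with a third disc is at least the diameter of \<open>T\<close>. This Lipschitz bound is what
  extends the supremum, and with it diameter and absolute value, to the completion.\<close>

lemma AKR_sup_le_dist:
  assumes "S \<in> AKR av" "T \<in> AKR av" "U \<in> AKR av"
  shows "AKR_sup av S U \<le> AKR_sup av T U + 2 * AKR_dist av S T"
  using assms AKR_sup_ultra[of S T U] AKR_sup_self_le[of S T] AKR_sup_self_le[of T S]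
    AKR_sup_self_le[of T U] AKR_sup_commute[of S T] AKR_dist_eq_sup[of S T]
  by (auto simp: field_simps)

lemma AKR_sup_diff_le:
  assumes "S \<in> AKR av" "T \<in> AKR av" "U \<in> AKR av" "V \<in> AKR av"
  shows "\<bar>AKR_sup av S U - AKR_sup av T V\<bar> \<le> 2 * AKR_dist av S T + 2 * AKR_dist av U V"
  using AKR_sup_le_dist[of S T U] AKR_sup_le_dist[of T S U] AKR_sup_le_dist[of U V T]
    AKR_sup_le_dist[of V U T] AKR_sup_commute[of T U] AKR_sup_commute[of T V]
    AKR.commute[of S T] AKR.commute[of U V] assms by auto

lemma null_squeeze:
  fixes f g :: "nat \<Rightarrow> real"
  assumes "\<And>n. 0 \<le> f n" "\<And>n. f n \<le> g n" "g \<longlonglongrightarrow> 0"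
  shows "f \<longlonglongrightarrow> 0"
  by (rule tendsto_sandwich[of "\<lambda>_. 0" f _ g]) (use assms in auto)

lemma cauchy_equiv_iff:
  "(s, t) \<in> cauchy_equiv (AKR av) (AKR_dist av) \<longleftrightarrow>
    AKR.MCauchy s \<and> AKR.MCauchy t \<and> (\<lambda>n. AKR_dist av (s n) (t n)) \<longlonglongrightarrow> 0"
  by (simp add: cauchy_equiv_def)

lemma MCauchy_mem: "AKR.MCauchy s \<Longrightarrow> s n \<in> AKR av"
  by (auto simp: AKR.MCauchy_def)

lemma equiv_cauchy_equiv:
  "equiv {s. AKR.MCauchy s} (cauchy_equiv (AKR av) (AKR_dist av))"
proof (rule equivI)
  show "cauchy_equiv (AKR av) (AKR_dist av) \<subseteq> {s. AKR.MCauchy s} \<times> {s. AKR.MCauchy s}"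
    by (auto simp: cauchy_equiv_iff)
  show "refl_on {s. AKR.MCauchy s} (cauchy_equiv (AKR av) (AKR_dist av))"
    using MCauchy_mem by (auto simp: refl_on_def cauchy_equiv_iff)
  show "sym (cauchy_equiv (AKR av) (AKR_dist av))"
    by (auto simp: sym_def cauchy_equiv_iff AKR.commute)
  show "trans (cauchy_equiv (AKR av) (AKR_dist av))"
  proof (rule transI, unfold cauchy_equiv_iff, intro conjI; (elim conjE)?)
    fix s t u
    assume "AKR.MCauchy s" "AKR.MCauchy t" "AKR.MCauchy u"
      and *: "(\<lambda>n. AKR_dist av (s n) (t n)) \<longlonglongrightarrow> 0" "(\<lambda>n. AKR_dist av (t n) (u n)) \<longlonglongrightarrow> 0"
    then have "AKR_dist av (s n) (u n) \<le> AKR_dist av (s n) (t n) + AKR_dist av (t n) (u n)" for n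
      by (intro AKR.triangle MCauchy_mem)
    then show "(\<lambda>n. AKR_dist av (s n) (u n)) \<longlonglongrightarrow> 0"
      using tendsto_add[OF *] by (intro null_squeeze[where f = "\<lambda>n. AKR_dist av (s n) (u n)"]) auto
  qed
qed

lemma AK_rep:
  assumes "S \<in> AK av"
  obtains s where "s \<in> S"
  using assms equiv_cauchy_equiv unfolding AK_def metric_completion_def
  by (metis all_not_in_conv in_quotient_imp_non_empty)

lemma AK_mem:
  assumes "S \<in> AK av" "s \<in> S"
  shows AK_mem_MCauchy: "AKR.MCauchy s" and AK_mem_AKR: "s n \<in> AKR av"
proof -
  show "AKR.MCauchy s"
    using assms in_quotient_imp_subset[OF equiv_cauchy_equiv]
    unfolding AK_def metric_completion_def by blast
  then show "s n \<in> AKR av" by (rule MCauchy_mem)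
qed

lemma AK_eq_iff:
  assumes "S \<in> AK av" "T \<in> AK av" "s \<in> S" "t \<in> T"
  shows "S = T \<longleftrightarrow> (\<lambda>n. AKR_dist av (s n) (t n)) \<longlonglongrightarrow> 0"
proof -
  have "S = T \<longleftrightarrow> (s, t) \<in> cauchy_equiv (AKR av) (AKR_dist av)"
    using quotient_eq_iff[OF equiv_cauchy_equiv] assms
    unfolding AK_def metric_completion_def by blast
  then show ?thesis using assms by (simp add: cauchy_equiv_iff AK_mem_MCauchy)
qed

lemma AKR_sup_convergent:
  assumes s: "AKR.MCauchy s" and t: "AKR.MCauchy t"
  shows "convergent (\<lambda>n. AKR_sup av (s n) (t n))"
  unfolding Cauchy_convergent_iff[symmetric]
proof (rule metric_CauchyI)
  fix e :: real assume "0 < e"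
  then have e: "0 < e / 4" by simp
  obtain N where N: "\<And>n m. N \<le> n \<Longrightarrow> N \<le> m \<Longrightarrow> AKR_dist av (s n) (s m) < e / 4"
    using s e unfolding AKR.MCauchy_def by blast
  obtain N' where N': "\<And>n m. N' \<le> n \<Longrightarrow> N' \<le> m \<Longrightarrow> AKR_dist av (t n) (t m) < e / 4"
    using t e unfolding AKR.MCauchy_def by blast
  have "dist (AKR_sup av (s m) (t m)) (AKR_sup av (s n) (t n)) < e"
    if "max N N' \<le> m" "max N N' \<le> n" for m n
    using AKR_sup_diff_le[OF MCauchy_mem[OF s, of m] MCauchy_mem[OF s, of n] MCauchy_mem[OF t, of m]
        MCauchy_mem[OF t, of n]] N[of m n] N'[of m n] that by (simp add: dist_real_def)
  then show "\<exists>M. \<forall>m\<ge>M. \<forall>n\<ge>M. dist (AKR_sup av (s m) (t m)) (AKR_sup av (s n) (t n)) < e"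
    by blast
qed

lemma AKR_sup_tendsto_unique:
  assumes "S \<in> AK av" "T \<in> AK av" "s \<in> S" "t \<in> T" "s' \<in> S" "t' \<in> T"
    and lim: "(\<lambda>n. AKR_sup av (s n) (t n)) \<longlonglongrightarrow> l"
  shows "(\<lambda>n. AKR_sup av (s' n) (t' n)) \<longlonglongrightarrow> l"
proof (rule LIM_zero_cancel, rule tendsto_rabs_zero_cancel)
  have s: "(\<lambda>n. AKR_dist av (s' n) (s n)) \<longlonglongrightarrow> 0" "(\<lambda>n. AKR_dist av (t' n) (t n)) \<longlonglongrightarrow> 0"
    using AK_eq_iff assms by blast+
  have l: "(\<lambda>n. \<bar>AKR_sup av (s n) (t n) - l\<bar>) \<longlonglongrightarrow> 0"
    using lim by (simp add: LIM_zero tendsto_rabs_zero)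
  have "\<bar>AKR_sup av (s' n) (t' n) - l\<bar>
      \<le> 2 * AKR_dist av (s' n) (s n) + 2 * AKR_dist av (t' n) (t n) + \<bar>AKR_sup av (s n) (t n) - l\<bar>" for n
    using AKR_sup_diff_le[of "s' n" "s n" "t' n" "t n"] assms AK_mem_AKR by force
  moreover have "(\<lambda>n. 2 * AKR_dist av (s' n) (s n) + 2 * AKR_dist av (t' n) (t n)
      + \<bar>AKR_sup av (s n) (t n) - l\<bar>) \<longlonglongrightarrow> 2 * 0 + 2 * 0 + 0"
    by (intro tendsto_intros s l)
  ultimately show "(\<lambda>n. \<bar>AKR_sup av (s' n) (t' n) - l\<bar>) \<longlonglongrightarrow> 0"
    by (intro null_squeeze[where f = "\<lambda>n. \<bar>AKR_sup av (s' n) (t' n) - l\<bar>"]) auto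
qed

lemma AK_sup_tendsto:
  assumes "S \<in> AK av" "T \<in> AK av" "s \<in> S" "t \<in> T"
  shows "(\<lambda>n. AKR_sup av (s n) (t n)) \<longlonglongrightarrow> AK_sup av S T"
proof -
  obtain l where l: "(\<lambda>n. AKR_sup av (s n) (t n)) \<longlonglongrightarrow> l"
    using AKR_sup_convergent AK_mem_MCauchy assms unfolding convergent_def by blast
  have "AK_sup av S T = l"
    unfolding AK_sup_def extend2_def
  proof (rule the_equality)
    show "\<forall>s\<in>S. \<forall>t\<in>T. (\<lambda>n. AKR_sup av (s n) (t n)) \<longlonglongrightarrow> l"
      using AKR_sup_tendsto_unique[OF assms _ _ l] by blast
  qed (use assms l LIMSEQ_unique in blast)
  then show ?thesis using l by simp
qed

lemma extend1_eq:
  assumes S: "S \<in> AK av" and f: "\<And>s. s \<in> S \<Longrightarrow> (\<lambda>n. f (s n)) \<longlonglongrightarrow> l"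
  shows "extend1 f S = l"
proof -
  obtain s where "s \<in> S" using S by (rule AK_rep)
  then show ?thesis
    unfolding extend1_def using f LIMSEQ_unique by (intro the_equality) blast+
qed

lemma MCauchy_class: "AKR.MCauchy s \<Longrightarrow> cauchy_equiv (AKR av) (AKR_dist av) `` {s} \<in> AK av"
  unfolding AK_def metric_completion_def by (intro quotientI) simp

lemma MCauchy_self: "AKR.MCauchy s \<Longrightarrow> s \<in> cauchy_equiv (AKR av) (AKR_dist av) `` {s}"
  using equiv_class_self[OF equiv_cauchy_equiv] by simp

lemma MCauchy_const: "D \<in> AKR av \<Longrightarrow> AKR.MCauchy (\<lambda>_. D)"
  by (auto simp: AKR.MCauchy_def)

lemma AK_embed_in_AK: "D \<in> AKR av \<Longrightarrow> AK_embed av D \<in> AK av"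
  unfolding AK_embed_def completion_embed_def by (intro MCauchy_class MCauchy_const)

lemma const_mem_AK_embed: "D \<in> AKR av \<Longrightarrow> (\<lambda>_. D) \<in> AK_embed av D"
  unfolding AK_embed_def completion_embed_def by (intro MCauchy_self MCauchy_const)

lemma AK_sup_embed: "D \<in> AKR av \<Longrightarrow> D' \<in> AKR av \<Longrightarrow>
    AK_sup av (AK_embed av D) (AK_embed av D') = AKR_sup av D D'"
  using AK_sup_tendsto[OF AK_embed_in_AK AK_embed_in_AK const_mem_AK_embed const_mem_AK_embed]
  by (simp add: LIMSEQ_const_iff)

lemma K_embed_in_AK: "K_embed av x \<in> AK av"
  by (simp add: K_embed_def AK_embed_in_AK disc_in_AKR)

lemma AK_sup_K_embed: "AK_sup av (K_embed av x) (K_embed av y) = av (x - y)"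
  using av_nonneg by (simp add: K_embed_def AK_sup_embed disc_in_AKR AKR_sup_disc max_def)

lemma AK_sup_K_embed_disc:
  "0 \<le> r \<Longrightarrow> AK_sup av (K_embed av x) (AK_embed av (disc av y r)) = max r (av (x - y))"
  by (simp add: K_embed_def AK_sup_embed disc_in_AKR AKR_sup_disc)

lemma AK_diam_eq_sup: "S \<in> AK av \<Longrightarrow> AK_diam S = AK_sup av S S"
  unfolding AK_diam_def using AK_sup_tendsto[of S S]
  by (intro extend1_eq) (auto simp: AKR_diam_eq_sup AK_mem_AKR)

lemma AK_abs_eq_sup: "S \<in> AK av \<Longrightarrow> AK_abs av S = AK_sup av (K_embed av 0) S"
  unfolding AK_abs_def K_embed_def
  using AK_sup_tendsto[OF AK_embed_in_AK _ const_mem_AK_embed, of "disc av 0 0"]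
  by (intro extend1_eq) (auto simp: AKR_abs_eq_sup AK_mem_AKR disc_in_AKR)

lemma AK_sup_nonneg:
  assumes "S \<in> AK av" "T \<in> AK av"
  shows "0 \<le> AK_sup av S T"
proof -
  obtain s t where st: "s \<in> S" "t \<in> T" using assms AK_rep by metis
  show ?thesis
    by (rule LIMSEQ_le_const[OF AK_sup_tendsto[OF assms st]])
      (use assms st in \<open>auto simp: AKR_sup_nonneg AK_mem_AKR\<close>)
qed

lemma AK_sup_commute:
  assumes "S \<in> AK av" "T \<in> AK av"
  shows "AK_sup av S T = AK_sup av T S"
proof -
  obtain s t where st: "s \<in> S" "t \<in> T" using assms AK_rep by metis
  then have "AKR_sup av (s n) (t n) = AKR_sup av (t n) (s n)" for n
    using assms by (intro AKR_sup_commute AK_mem_AKR)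
  then show ?thesis
    using AK_sup_tendsto[OF assms st] AK_sup_tendsto[OF assms(2,1) st(2,1)] LIMSEQ_unique by simp
qed

lemma AK_sup_ultra:
  assumes "S \<in> AK av" "T \<in> AK av" "U \<in> AK av"
  shows "AK_sup av S U \<le> max (AK_sup av S T) (AK_sup av T U)"
proof -
  obtain s t u where st: "s \<in> S" "t \<in> T" "u \<in> U" using assms AK_rep by metis
  show ?thesis
    by (rule LIMSEQ_le[OF AK_sup_tendsto[OF assms(1,3) st(1,3)]
          tendsto_max[OF AK_sup_tendsto[OF assms(1,2) st(1,2)] AK_sup_tendsto[OF assms(2,3) st(2,3)]]])
      (meson AKR_sup_ultra AK_mem_AKR assms st)
qed

lemma AK_sup_self_le: "S \<in> AK av \<Longrightarrow> T \<in> AK av \<Longrightarrow> AK_sup av S S \<le> AK_sup av S T"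
  using AK_sup_ultra[of S T S] AK_sup_commute[of S T] by simp

lemma AK_eqI:
  assumes S: "S \<in> AK av" and T: "T \<in> AK av"
    and le: "AK_sup av S T \<le> AK_sup av S S" "AK_sup av S T \<le> AK_sup av T T"
  shows "S = T"
proof -
  obtain s t where st: "s \<in> S" "t \<in> T" using S T AK_rep by metis
  have "AK_sup av S T = AK_sup av S S" "AK_sup av S T = AK_sup av T T"
    using le AK_sup_self_le[OF S T] AK_sup_self_le[OF T S] AK_sup_commute[OF S T] by auto
  moreover have "(\<lambda>n. AKR_sup av (s n) (t n) - (AKR_sup av (s n) (s n) + AKR_sup av (t n) (t n)) / 2)
      \<longlonglongrightarrow> AK_sup av S T - (AK_sup av S S + AK_sup av T T) / 2"
    using S T st by (intro tendsto_intros AK_sup_tendsto) auto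
  ultimately have "(\<lambda>n. AKR_dist av (s n) (t n)) \<longlonglongrightarrow> 0"
    using S T st by (simp add: AKR_dist_eq_sup AK_mem_AKR)
  then show ?thesis using AK_eq_iff[OF S T st] by simp
qed

text \<open>The centre of a late enough disc in a Cauchy sequence representing \<open>S\<close> will do: its supremum with
  its own disc is the diameter of that disc, and the later discs are close to it.\<close>

lemma AK_approx_centre:
  assumes S: "S \<in> AK av" and e: "0 < e"
  shows "\<exists>c. AK_sup av (K_embed av c) S < AK_sup av S S + e"
proof -
  obtain s where s: "s \<in> S" using S AK_rep by metis
  have sA: "s n \<in> AKR av" for n using AK_mem_AKR[OF S s] .
  have "eventually (\<lambda>n. AKR_sup av (s n) (s n) < AK_sup av S S + e / 4) sequentially"
    using AK_sup_tendsto[OF S S s s] e by (intro order_tendstoD) auto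
  then obtain N where N: "\<And>n. n \<ge> N \<Longrightarrow> AKR_sup av (s n) (s n) < AK_sup av S S + e / 4"
    by (auto simp: eventually_sequentially)
  obtain M where M: "\<And>n m. M \<le> n \<Longrightarrow> M \<le> m \<Longrightarrow> AKR_dist av (s n) (s m) < e / 4"
    using AK_mem_MCauchy[OF S s] e unfolding AKR.MCauchy_def
    by (metis zero_less_divide_iff zero_less_numeral)
  define k where "k = max M N"
  obtain c r where c: "0 \<le> r" "s k = disc av c r" using sA[of k] by (rule AKR_cases)
  have le: "AKR_sup av (disc av c 0) (s n) \<le> AK_sup av S S + 3 * e / 4" if n: "n \<ge> k" for n
  proof -
    have "AKR_sup av (disc av c 0) (s k) = AKR_sup av (s k) (s k)"
      using c by (simp add: AKR_sup_disc)
    then have "AKR_sup av (s n) (disc av c 0)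
        \<le> AKR_sup av (s k) (s k) + 2 * AKR_dist av (s n) (s k)"
      using AKR_sup_le_dist[of "s n" "s k" "disc av c 0"] sA disc_in_AKR[of 0 c]
        AKR_sup_commute[of "s k" "disc av c 0"] by simp
    then show ?thesis
      using N[of k] M[of n k] n sA disc_in_AKR[of 0 c] AKR_sup_commute[of "s n" "disc av c 0"]
      by (simp add: k_def)
  qed
  have "AK_sup av (K_embed av c) S \<le> AK_sup av S S + 3 * e / 4"
    unfolding K_embed_def
    by (rule LIMSEQ_le_const2[OF AK_sup_tendsto[OF AK_embed_in_AK S const_mem_AK_embed s]])
      (use le in \<open>auto simp: disc_in_AKR\<close>)
  then show ?thesis using e by (intro exI[of _ c]) simp
qed

text \<open>Any \<open>c\<close> bounds \<open>sup{S, T}\<close> by the common value of \<open>sup{c, S}\<close> and \<open>sup{c, T}\<close>, which comes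
  arbitrarily close to the diameters.\<close>

lemma AK_eq_if_sup_K_eq:
  assumes S: "S \<in> AK av" and T: "T \<in> AK av"
    and eq: "\<And>c. AK_sup av (K_embed av c) S = AK_sup av (K_embed av c) T"
  shows "S = T"
proof -
  have *: "AK_sup av S T \<le> AK_sup av (K_embed av c) S" for c
    using AK_sup_ultra[OF S K_embed_in_AK T, of c] eq[of c] AK_sup_commute[OF S K_embed_in_AK, of c]
    by simp
  show ?thesis
  proof (rule AK_eqI[OF S T]; rule field_le_epsilon)
    fix e :: real assume e: "0 < e"
    show "AK_sup av S T \<le> AK_sup av S S + e"
      using AK_approx_centre[OF S e] * by (meson less_imp_le order_trans)
    show "AK_sup av S T \<le> AK_sup av T T + e"
      using AK_approx_centre[OF T e] * eq by (metis less_imp_le order_trans)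
  qed
qed

text \<open>An element of a larger ultrametric space would have the distances \<open>\<phi>\<close> to the points of \<open>K\<close>.
  The discs with centre \<open>a\<close> and radius \<open>\<phi> a\<close> form a chain, and they converge when \<open>\<phi> a\<close> tends to
  the infimum of \<open>\<phi>\<close>.\<close>

lemma AK_point_of_distances:
  assumes nonneg: "\<And>a. 0 \<le> \<phi> a"
    and ultra: "\<And>a b. \<phi> a \<le> max (av (a - b)) (\<phi> b)"
    and sep: "\<And>a b. av (a - b) \<le> max (\<phi> a) (\<phi> b)"
  shows "\<exists>S\<in>AK av. \<forall>c. AK_sup av (K_embed av c) S = \<phi> c"
proof -
  define r where "r = Inf (range \<phi>)"
  have bdd: "bdd_below (range \<phi>)" using nonneg by (auto intro!: bdd_belowI[of _ 0])
  have r_le: "r \<le> \<phi> a" for a unfolding r_def using bdd by (simp add: cInf_lower)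
  have "\<exists>a. \<phi> a < r + 1 / real (Suc n)" for n
    using cInf_lessD[of "range \<phi>" "r + 1 / real (Suc n)"] by (auto simp: r_def)
  then obtain a where a: "\<And>n. \<phi> (a n) < r + 1 / real (Suc n)" by metis
  have "\<phi> (a n) - r \<le> 1 / real (Suc n)" for n using a[of n] by linarith
  then have "(\<lambda>n. \<phi> (a n) - r) \<longlonglongrightarrow> 0"
    using r_le by (intro null_squeeze[OF _ _ LIMSEQ_Suc[OF lim_1_over_n]]) auto
  then have lim: "(\<lambda>n. \<phi> (a n)) \<longlonglongrightarrow> r"
    by (rule LIM_zero_cancel)
  define s where "s n = disc av (a n) (\<phi> (a n))" for n
  have dist: "AKR_dist av (s n) (s m) \<le> \<bar>\<phi> (a n) - \<phi> (a m)\<bar>" for n m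
    using sep[of "a n" "a m"] nonneg
    by (simp add: s_def AKR_dist_disc max_absorb1) (simp add: max_def abs_if)
  have sA: "s n \<in> AKR av" for n using nonneg by (simp add: s_def disc_in_AKR)
  have C: "AKR.MCauchy s"
    unfolding AKR.MCauchy_def
  proof (intro conjI allI impI)
    show "range s \<subseteq> AKR av" using sA by auto
    fix e :: real assume e: "e > 0"
    obtain N where "\<forall>m\<ge>N. \<forall>n\<ge>N. \<bar>\<phi> (a m) - \<phi> (a n)\<bar> < e"
      using LIMSEQ_imp_Cauchy[OF lim] e unfolding Cauchy_def dist_real_def by blast
    then show "\<exists>N. \<forall>n n'. N \<le> n \<longrightarrow> N \<le> n' \<longrightarrow> AKR_dist av (s n) (s n') < e"
      using dist le_less_trans by (metis order.strict_trans1)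
  qed
  define S where "S = cauchy_equiv (AKR av) (AKR_dist av) `` {s}"
  have S: "S \<in> AK av" "s \<in> S" using MCauchy_class[OF C] MCauchy_self[OF C] by (auto simp: S_def)
  have "AK_sup av (K_embed av c) S = \<phi> c" for c
  proof (rule LIMSEQ_unique)
    show "(\<lambda>n. AKR_sup av (disc av c 0) (s n)) \<longlonglongrightarrow> AK_sup av (K_embed av c) S"
      unfolding K_embed_def
      by (intro AK_sup_tendsto AK_embed_in_AK const_mem_AK_embed S) (simp_all add: disc_in_AKR)
    have "AKR_sup av (disc av c 0) (s n) = max (\<phi> (a n)) (av (c - a n))" for n
      using nonneg by (simp add: s_def AKR_sup_disc)
    moreover have "(\<lambda>n. max (\<phi> (a n)) (av (c - a n))) \<longlonglongrightarrow> \<phi> c"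
    proof (rule tendsto_sandwich)
      show "\<forall>\<^sub>F n in sequentially. \<phi> c \<le> max (\<phi> (a n)) (av (c - a n))"
        using ultra[of c] by (simp add: max.commute)
      show "\<forall>\<^sub>F n in sequentially. max (\<phi> (a n)) (av (c - a n)) \<le> max (\<phi> (a n)) (\<phi> c)"
        using sep[of c] by (simp add: max.commute[of "\<phi> c"])
      show "(\<lambda>n. max (\<phi> (a n)) (\<phi> c)) \<longlonglongrightarrow> \<phi> c"
        using tendsto_max[OF lim tendsto_const[of "\<phi> c"]] r_le[of c] by (simp add: max_absorb2)
    qed (rule tendsto_const)
    ultimately show "(\<lambda>n. AKR_sup av (disc av c 0) (s n)) \<longlonglongrightarrow> \<phi> c" by simp
  qed
  then show ?thesis using S by blast
qed

end


section \<open>Minimal Cauchy filters from points of the tree\<close>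

definition P1_absdiff :: "('k::field \<Rightarrow> real) \<Rightarrow> 'k \<Rightarrow> 'k option \<Rightarrow> ereal" where
  "P1_absdiff av c p = (case p of None \<Rightarrow> \<infinity> | Some z \<Rightarrow> ereal (av (z - c)))"

definition PK_absdiff :: "('k::field \<Rightarrow> real) \<Rightarrow> 'k \<Rightarrow> 'k tree_point option \<Rightarrow> ereal" where
  "PK_absdiff av c p = (case p of None \<Rightarrow> \<infinity> | Some S \<Rightarrow> ereal (AK_sup av (K_embed av c) S))"

text \<open>The infimum of inverse images makes being finer than this filter the same as a family of limit
  statements; with values in the extended reals they cover the point at infinity as well.\<close>

definition tree_filter :: "('k::field \<Rightarrow> real) \<Rightarrow> 'k tree_point option \<Rightarrow> 'k option filter" where
  "tree_filter av p = (INF c. filtercomap (P1_absdiff av c) (nhds (PK_absdiff av c p)))"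

lemma P1_absdiff_simps [simp]:
  "P1_absdiff av c None = \<infinity>" "P1_absdiff av c (Some z) = ereal (av (z - c))"
  by (simp_all add: P1_absdiff_def)

lemma PK_absdiff_simps [simp]:
  "PK_absdiff av c None = \<infinity>" "PK_absdiff av c (Some S) = ereal (AK_sup av (K_embed av c) S)"
  by (simp_all add: PK_absdiff_def)

lemma le_tree_filter_iff:
  "F \<le> tree_filter av p \<longleftrightarrow> (\<forall>c. (P1_absdiff av c \<longlongrightarrow> PK_absdiff av c p) F)"
  by (simp add: tree_filter_def le_INF_iff filterlim_iff_le_filtercomap)

lemma PK_cases:
  assumes "p \<in> PK av"
  obtains "p = None" | S where "S \<in> AK av" "p = Some S"
  using assms by (auto simp: PK_def)

context ultrametric_field
begin

lemma AK_sup_K_ultra: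
  assumes "S \<in> AK av"
  shows "AK_sup av (K_embed av a) S \<le> max (av (a - b)) (AK_sup av (K_embed av b) S)"
    and "av (a - b) \<le> max (AK_sup av (K_embed av a) S) (AK_sup av (K_embed av b) S)"
  using AK_sup_ultra[OF K_embed_in_AK K_embed_in_AK assms, of a b]
    AK_sup_ultra[OF K_embed_in_AK assms K_embed_in_AK, of a b]
    AK_sup_commute[OF assms K_embed_in_AK, of b]
  by (simp_all add: AK_sup_K_embed)

lemma PK_absdiff_nonneg: "p \<in> PK av \<Longrightarrow> 0 \<le> PK_absdiff av c p"
  by (auto elim!: PK_cases simp: AK_sup_nonneg K_embed_in_AK)

lemma P1_embed_in_PK: "P1_embed av z \<in> PK av"
  by (cases z) (auto simp: P1_embed_def PK_def K_embed_in_AK)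

lemma PK_absdiff_P1_embed: "PK_absdiff av c (P1_embed av z) = P1_absdiff av c z"
  by (cases z) (auto simp: P1_embed_def AK_sup_K_embed av_diff_commute)

lemma PK_absdiff_inj:
  assumes "p \<in> PK av" "q \<in> PK av" "\<And>c. PK_absdiff av c p = PK_absdiff av c q"
  shows "p = q"
  using assms AK_eq_if_sup_K_eq by (elim PK_cases) simp_all

text \<open>Let \<open>a\<close> be a point of \<open>X\<close> where the prescribed distance is smallest. A point generic with
  respect to \<open>X\<close> in a disc about \<open>a\<close>, of radius in the value group and close to that smallest distance,
  approximates all the prescribed distances to \<open>X\<close>; the side from which the radius approaches
  decides the side of the approximation.\<close>

lemma approx_above:
  assumes S: "S \<in> AK av" and X: "finite X" "X \<noteq> {}" and e: "0 < e"
  shows "\<exists>z. \<forall>c\<in>X. AK_sup av (K_embed av c) S \<le> av (z - c)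
    \<and> av (z - c) < AK_sup av (K_embed av c) S + e"
proof -
  define \<phi> where "\<phi> c = AK_sup av (K_embed av c) S" for c
  obtain a where a: "a \<in> X" "\<And>c. c \<in> X \<Longrightarrow> \<phi> a \<le> \<phi> c"
    using ex_min_if_finite[of "\<phi> ` X"] X by (auto simp: not_less)
  have "0 \<le> \<phi> a" by (simp add: \<phi>_def AK_sup_nonneg S K_embed_in_AK)
  then obtain s where s: "s \<in> value_group av" "\<phi> a < s" "s < \<phi> a + e"
    using value_group_dense[of "\<phi> a" "\<phi> a + e"] e by auto
  obtain z where z: "av (z - a) \<le> s" "\<forall>b\<in>X. max s (av (a - b)) \<le> av (z - b)"
    using generic_point[OF s(1) X(1)] by blast
  have "\<phi> c \<le> av (z - c) \<and> av (z - c) < \<phi> c + e" if c: "c \<in> X" for c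
  proof -
    have "\<phi> c \<le> max (av (a - c)) (\<phi> a)" "av (a - c) \<le> max (\<phi> a) (\<phi> c)"
      using AK_sup_K_ultra(1)[OF S, of c a] AK_sup_K_ultra(2)[OF S, of a c] av_diff_commute[of a c]
      by (simp_all add: \<phi>_def)
    moreover have "max s (av (a - c)) \<le> av (z - c)" using z c by blast
    moreover have "av (z - c) \<le> max (av (z - a)) (av (a - c))" by (rule av_triangle)
    ultimately show ?thesis using a(2)[OF c] z(1) s e by linarith
  qed
  then show ?thesis unfolding \<phi>_def by blast
qed

lemma approx_below:
  assumes S: "S \<in> AK av" and X: "finite X" "X \<noteq> {}" and e: "0 < e"
  shows "\<exists>z. \<forall>c\<in>X. AK_sup av (K_embed av c) S - e < av (z - c)
    \<and> av (z - c) \<le> AK_sup av (K_embed av c) S"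
proof -
  define \<phi> where "\<phi> c = AK_sup av (K_embed av c) S" for c
  obtain a where a: "a \<in> X" "\<And>c. c \<in> X \<Longrightarrow> \<phi> a \<le> \<phi> c"
    using ex_min_if_finite[of "\<phi> ` X"] X by (auto simp: not_less)
  have \<phi>a: "0 \<le> \<phi> a" by (simp add: \<phi>_def AK_sup_nonneg S K_embed_in_AK)
  have \<phi>: "\<phi> c \<le> max (av (a - c)) (\<phi> a)" "av (a - c) \<le> max (\<phi> a) (\<phi> c)" for c
    using AK_sup_K_ultra(1)[OF S, of c a] AK_sup_K_ultra(2)[OF S, of a c] av_diff_commute[of a c]
      by (simp_all add: \<phi>_def)
  show ?thesis
  proof (cases "\<phi> a = 0")
    case True
    have "\<phi> c - e < av (a - c) \<and> av (a - c) \<le> \<phi> c" if c: "c \<in> X" for c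
      using \<phi>[of c] True a(2)[OF c] av_nonneg[of "a - c"] e by linarith
    then show ?thesis unfolding \<phi>_def by blast
  next
    case False
    then obtain s where s: "s \<in> value_group av" "\<phi> a - e < s" "s < \<phi> a"
      using value_group_dense[of "max 0 (\<phi> a - e)" "\<phi> a"] e \<phi>a by auto
    obtain z where z: "av (z - a) \<le> s" "\<forall>b\<in>X. max s (av (a - b)) \<le> av (z - b)"
      using generic_point[OF s(1) X(1)] by blast
    have "\<phi> c - e < av (z - c) \<and> av (z - c) \<le> \<phi> c" if c: "c \<in> X" for c
    proof -
      have "max s (av (a - c)) \<le> av (z - c)" using z c by blast
      moreover have "av (z - c) \<le> max (av (z - a)) (av (a - c))" by (rule av_triangle)
      ultimately show ?thesis using \<phi>[of c] a(2)[OF c] z(1) s e by linarith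
    qed
    then show ?thesis unfolding \<phi>_def by blast
  qed
qed

text \<open>An infimum of filters is proper as soon as all finite subinfima are; adding the principal filter
  of \<open>P\<close> to each of them shows that \<open>P\<close> is not negligible. Prescribing \<open>a \<in> X\<close> lets \<open>P\<close> be a condition
  on the distance to \<open>a\<close>.\<close>

lemma tree_filter_frequentlyI:
  assumes seq: "\<And>X. finite X \<Longrightarrow> X \<noteq> {} \<Longrightarrow> a \<in> X \<Longrightarrow>
    \<exists>z. (\<forall>n::nat. P (z n)) \<and> (\<forall>c\<in>X. (\<lambda>n. P1_absdiff av c (z n)) \<longlonglongrightarrow> PK_absdiff av c p)"
  shows "\<exists>\<^sub>F z in tree_filter av p. P z"
proof -
  define G where "G c = inf (filtercomap (P1_absdiff av c) (nhds (PK_absdiff av c p)))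
    (principal {z. P z})" for c
  have "(INF c\<in>UNIV. G c) \<noteq> bot"
  proof (rule INF_filter_not_bot)
    fix X :: "'k set" assume "finite X"
    then obtain z where z: "\<And>n::nat. P (z n)"
      "\<And>c. c \<in> insert a X \<Longrightarrow> (\<lambda>n. P1_absdiff av c (z n)) \<longlonglongrightarrow> PK_absdiff av c p"
      using seq[of "insert a X"] by auto
    have "filtermap z sequentially \<le> (INF c\<in>X. G c)"
      using z by (auto simp: le_INF_iff G_def filtermap_le_iff_le_filtercomap le_principal
          eventually_filtermap filterlim_def filtermap_filtermap)
        (simp add: filtercomap_filtercomap filtermap_le_iff_le_filtercomap)
    then show "(INF c\<in>X. G c) \<noteq> bot"
      by (metis filtermap_bot_iff le_bot sequentially_bot)
  qed
  moreover have "(INF c\<in>UNIV. G c) \<le> inf (tree_filter av p) (principal {z. P z})"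
    unfolding tree_filter_def
    by (intro inf_greatest INF_mono' INF_lower2[of undefined]) (simp_all add: G_def)
  ultimately have "inf (tree_filter av p) (principal {z. P z}) \<noteq> bot"
    by (metis le_bot)
  then show ?thesis
    by (simp add: frequently_def trivial_limit_def eventually_inf_principal)
qed

lemma frequently_ge_tree_filter:
  assumes p: "p \<in> PK av"
  shows "\<exists>\<^sub>F z in tree_filter av p. PK_absdiff av a p \<le> P1_absdiff av a z"
  using p
proof (cases rule: PK_cases)
  case 1
  then show ?thesis by (intro tree_filter_frequentlyI[of a]) (auto intro!: exI[of _ "\<lambda>_. None"])
next
  case (2 S)
  show ?thesis
  proof (rule tree_filter_frequentlyI[of a])
    fix X :: "'k set" assume X: "finite X" "X \<noteq> {}" "a \<in> X"
    let ?\<phi> = "\<lambda>c. AK_sup av (K_embed av c) S"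
    have "\<exists>z. \<forall>c\<in>X. ?\<phi> c \<le> av (z - c) \<and> av (z - c) < ?\<phi> c + 1 / real (Suc n)" for n
      using 2 X by (intro approx_above) auto
    then obtain z where z: "\<And>n c. c \<in> X \<Longrightarrow> ?\<phi> c \<le> av (z n - c)"
      "\<And>n c. c \<in> X \<Longrightarrow> av (z n - c) < ?\<phi> c + 1 / real (Suc n)"
      by metis
    have "(\<lambda>n. av (z n - c)) \<longlonglongrightarrow> ?\<phi> c" if c: "c \<in> X" for c
      by (rule LIM_zero_cancel, rule null_squeeze[OF _ _ LIMSEQ_Suc[OF lim_1_over_n]])
        (use z[OF c] in \<open>auto simp: less_imp_le diff_le_eq add.commute\<close>)
    then show "\<exists>z. (\<forall>n::nat. PK_absdiff av a p \<le> P1_absdiff av a (z n))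
        \<and> (\<forall>c\<in>X. (\<lambda>n. P1_absdiff av c (z n)) \<longlonglongrightarrow> PK_absdiff av c p)"
      using 2 X z by (intro exI[of _ "\<lambda>n. Some (z n)"]) auto
  qed
qed

lemma frequently_le_tree_filter:
  assumes p: "p \<in> PK av"
  shows "\<exists>\<^sub>F z in tree_filter av p. P1_absdiff av a z \<le> PK_absdiff av a p"
  using p
proof (cases rule: PK_cases)
  case 1
  then show ?thesis by (intro tree_filter_frequentlyI[of a]) (auto intro!: exI[of _ "\<lambda>_. None"])
next
  case (2 S)
  show ?thesis
  proof (rule tree_filter_frequentlyI[of a])
    fix X :: "'k set" assume X: "finite X" "X \<noteq> {}" "a \<in> X"
    let ?\<phi> = "\<lambda>c. AK_sup av (K_embed av c) S"
    have "\<exists>z. \<forall>c\<in>X. ?\<phi> c - 1 / real (Suc n) < av (z - c) \<and> av (z - c) \<le> ?\<phi> c" for n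
      using 2 X by (intro approx_below) auto
    then obtain z where z: "\<And>n c. c \<in> X \<Longrightarrow> ?\<phi> c - 1 / real (Suc n) < av (z n - c)"
      "\<And>n c. c \<in> X \<Longrightarrow> av (z n - c) \<le> ?\<phi> c"
      by metis
    have "(\<lambda>n. av (z n - c)) \<longlonglongrightarrow> ?\<phi> c" if c: "c \<in> X" for c
    proof -
      have "(\<lambda>n. ?\<phi> c - av (z n - c)) \<longlonglongrightarrow> 0"
        by (rule null_squeeze[OF _ _ LIMSEQ_Suc[OF lim_1_over_n]])
          (use z[OF c] in \<open>auto simp: less_imp_le diff_le_eq add.commute diff_less_eq\<close>)
      from tendsto_diff[OF tendsto_const[of "?\<phi> c"] this] show ?thesis by simp
    qed
    then show "\<exists>z. (\<forall>n::nat. P1_absdiff av a (z n) \<le> PK_absdiff av a p)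
        \<and> (\<forall>c\<in>X. (\<lambda>n. P1_absdiff av c (z n)) \<longlonglongrightarrow> PK_absdiff av c p)"
      using 2 X z by (intro exI[of _ "\<lambda>n. Some (z n)"]) auto
  qed
qed

lemma tree_filter_ne_bot: "p \<in> PK av \<Longrightarrow> tree_filter av p \<noteq> bot"
  using frequently_ge_tree_filter[of p] by (auto simp: frequently_def)

lemma tree_filter_tendsto: "(P1_absdiff av c \<longlongrightarrow> PK_absdiff av c p) (tree_filter av p)"
  using le_tree_filter_iff[of "tree_filter av p" av p] by simp

text \<open>The ball condition is strict although limits only preserve weak inequalities: the points at
  distance at least (at most) the limit value are never negligible.\<close>

lemma tree_filter_less_iff:
  assumes "p \<in> PK av"
  shows "filter_mem {z. P1_absdiff av a z < r} (tree_filter av p) \<longleftrightarrow> PK_absdiff av a p < r"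
proof
  assume "filter_mem {z. P1_absdiff av a z < r} (tree_filter av p)"
  then have "\<exists>z. PK_absdiff av a p \<le> P1_absdiff av a z \<and> P1_absdiff av a z < r"
    using frequently_ge_tree_filter[OF assms, of a] frequently_eventually_conj frequently_ex
    by (fastforce simp: filter_mem_def)
  then show "PK_absdiff av a p < r" by auto
qed (simp add: filter_mem_def order_tendstoD(2)[OF tree_filter_tendsto])

lemma tree_filter_greater_iff:
  assumes "p \<in> PK av"
  shows "filter_mem {z. r < P1_absdiff av a z} (tree_filter av p) \<longleftrightarrow> r < PK_absdiff av a p"
proof
  assume "filter_mem {z. r < P1_absdiff av a z} (tree_filter av p)"
  then have "\<exists>z. P1_absdiff av a z \<le> PK_absdiff av a p \<and> r < P1_absdiff av a z"
    using frequently_le_tree_filter[OF assms, of a] frequently_eventually_conj frequently_ex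
    by (fastforce simp: filter_mem_def)
  then show "r < PK_absdiff av a p" by auto
qed (simp add: filter_mem_def order_tendstoD(1)[OF tree_filter_tendsto])

lemma tree_filter_le_imp_eq:
  assumes "p \<in> PK av" "q \<in> PK av" "tree_filter av p \<le> tree_filter av q"
  shows "p = q"
proof (rule PK_absdiff_inj[OF assms(1,2)])
  fix c
  have "(P1_absdiff av c \<longlongrightarrow> PK_absdiff av c q) (tree_filter av p)"
    using assms(3) by (simp add: le_tree_filter_iff)
  then show "PK_absdiff av c p = PK_absdiff av c q"
    using tendsto_unique[OF tree_filter_ne_bot[OF assms(1)] tree_filter_tendsto] by blast
qed


section \<open>Balls of the projective line\<close>

lemma ball_eq_absdiff:
  "Some ` {z. av (z - a) < r} = {z. P1_absdiff av a z < ereal r}"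
  "Some ` {z. av (z - a) \<le> r} = {z. P1_absdiff av a z \<le> ereal r}"
  "- (Some ` {z. av (z - a) < r}) = {z. ereal r \<le> P1_absdiff av a z}"
  "- (Some ` {z. av (z - a) \<le> r}) = {z. ereal r < P1_absdiff av a z}"
proof -
  have *: "Some z \<in> Some ` A \<longleftrightarrow> z \<in> A" for z :: 'k and A by auto
  show "Some ` {z. av (z - a) < r} = {z. P1_absdiff av a z < ereal r}"
    "Some ` {z. av (z - a) \<le> r} = {z. P1_absdiff av a z \<le> ereal r}"
    "- (Some ` {z. av (z - a) < r}) = {z. ereal r \<le> P1_absdiff av a z}"
    "- (Some ` {z. av (z - a) \<le> r}) = {z. ereal r < P1_absdiff av a z}"
    by (rule set_eqI; case_tac x; auto simp: *)+
qed

lemma P1_open_ball_iff: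
  "P1_open_ball av B \<longleftrightarrow> (\<exists>a. \<exists>r\<in>value_group av.
     B = {z. P1_absdiff av a z < ereal r} \<or> B = {z. ereal r < P1_absdiff av a z})"
  unfolding P1_open_ball_def K_open_ball_def K_closed_ball_def ball_eq_absdiff[symmetric] by blast

lemma P1_closed_ball_iff:
  "P1_closed_ball av B \<longleftrightarrow> (\<exists>a. \<exists>r\<in>value_group av.
     B = {z. P1_absdiff av a z \<le> ereal r} \<or> B = {z. ereal r \<le> P1_absdiff av a z})"
  unfolding P1_closed_ball_def K_open_ball_def K_closed_ball_def ball_eq_absdiff[symmetric] by blast

lemma P1_closed_ball_Compl: "P1_closed_ball av (- B) \<longleftrightarrow> P1_open_ball av B"
  unfolding P1_closed_ball_def P1_open_ball_def by (metis double_compl)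

lemma irrational_le_iff: "r \<notin> value_group av \<Longrightarrow> 0 < r \<Longrightarrow> av x \<le> r \<longleftrightarrow> av x < r"
  by (auto simp: less_le value_group_iff av_eq_0_iff)

lemma P1_irrational_ball_iff:
  "P1_irrational_ball av B \<longleftrightarrow> (\<exists>a r. r > 0 \<and> r \<notin> value_group av \<and>
     (B = {z. P1_absdiff av a z < ereal r} \<or> B = {z. ereal r < P1_absdiff av a z}))"
proof -
  have eq: "{z. av (z - a) \<le> r} = {z. av (z - a) < r}" if "r > 0" "r \<notin> value_group av" for a r
    using that by (simp add: irrational_le_iff)
  show ?thesis
    unfolding P1_irrational_ball_def K_irrational_ball_def ball_eq_absdiff[symmetric]
  proof (intro iffI; elim exE conjE)
    fix D a r
    assume "B = Some ` D \<or> B = - (Some ` D)" "r > 0" "r \<notin> value_group av" "D = {z. av (z - a) \<le> r}"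
    then show "\<exists>a r. 0 < r \<and> r \<notin> value_group av
        \<and> (B = Some ` {z. av (z - a) < r} \<or> B = - (Some ` {z. av (z - a) \<le> r}))"
      using eq[of r a] by metis
  next
    fix a r
    assume "B = Some ` {z. av (z - a) < r} \<or> B = - (Some ` {z. av (z - a) \<le> r})"
      "r > 0" "r \<notin> value_group av"
    then show "\<exists>D. (\<exists>a r. 0 < r \<and> r \<notin> value_group av \<and> D = {z. av (z - a) \<le> r})
        \<and> (B = Some ` D \<or> B = - (Some ` D))"
      using eq[of r a] by metis
  qed
qed

lemma P1_irrational_ball_Compl: "P1_irrational_ball av (- B) \<longleftrightarrow> P1_irrational_ball av B"
  unfolding P1_irrational_ball_def by (metis double_compl)

lemma open_or_irrational_ball_cases:
  assumes "P1_open_ball av B \<or> P1_irrational_ball av B"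
  obtains a r where "0 < r" "B = {z. P1_absdiff av a z < ereal r}"
    | a r where "0 < r" "B = {z. ereal r < P1_absdiff av a z}"
  using assms value_group_pos unfolding P1_open_ball_iff P1_irrational_ball_iff by blast

text \<open>Only the trace of \<open>\<B>\<close> occurs on the right-hand side, so the trace determines the ball, for whatever
  radius and centre it is presented with: no comparison of radii is needed to find the
  corresponding ball.\<close>

lemma PK_open_ball_eq:
  assumes "PK_open_ball av \<B>"
  shows "\<B> = {p \<in> PK av. filter_mem (P1_embed av -` \<B>) (tree_filter av p)}"
proof -
  from assms consider \<D> where "AK_open_ball av \<D>" "\<B> = Some ` \<D>"
    | \<D> where "AK_closed_ball av \<D>" "\<B> = PK av - Some ` \<D>"
    unfolding PK_open_ball_def by (elim disjE exE conjE)
  then show ?thesis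
  proof cases
    case (1 \<D>)
    then obtain a r where \<D>: "\<D> = {S \<in> AK av. AK_sup av (K_embed av a) S < r}"
      by (auto simp: AK_open_ball_def)
    then have \<B>: "\<B> = {p \<in> PK av. PK_absdiff av a p < ereal r}"
      unfolding 1(2) \<D> by (auto simp: PK_def)
    then have "P1_embed av -` \<B> = {z. P1_absdiff av a z < ereal r}"
      by (auto simp: PK_absdiff_P1_embed P1_embed_in_PK)
    then show ?thesis using \<B> by (auto simp: tree_filter_less_iff)
  next
    case (2 \<D>)
    then obtain a r where \<D>: "\<D> = {S \<in> AK av. AK_sup av (K_embed av a) S \<le> r}"
      by (auto simp: AK_closed_ball_def)
    then have \<B>: "\<B> = {p \<in> PK av. ereal r < PK_absdiff av a p}"
      unfolding 2(2) \<D> by (auto simp: PK_def)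
    then have "P1_embed av -` \<B> = {z. ereal r < P1_absdiff av a z}"
      by (auto simp: PK_absdiff_P1_embed P1_embed_in_PK)
    then show ?thesis using \<B> by (auto simp: tree_filter_greater_iff)
  qed
qed

lemma PK_open_ball_exists:
  assumes "P1_open_ball av B \<or> P1_irrational_ball av B"
  shows "\<exists>\<B>. PK_open_ball av \<B> \<and> P1_embed av -` \<B> = B"
  using assms
proof (cases rule: open_or_irrational_ball_cases)
  case (1 a r)
  have "PK_open_ball av (Some ` {S \<in> AK av. AK_sup av (K_embed av a) S < r})"
    using 1 unfolding PK_open_ball_def AK_open_ball_def by blast
  moreover have "P1_embed av z \<in> Some ` {S \<in> AK av. AK_sup av (K_embed av a) S < r}
      \<longleftrightarrow> P1_absdiff av a z < ereal r" for z
    using K_embed_in_AK by (cases z) (auto simp: P1_embed_def AK_sup_K_embed av_diff_commute)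
  ultimately show ?thesis using 1 by blast
next
  case (2 a r)
  have "AK_closed_ball av {S \<in> AK av. AK_sup av (K_embed av a) S \<le> r}"
    using 2 by (auto simp: AK_closed_ball_def)
  then have "PK_open_ball av (PK av - Some ` {S \<in> AK av. AK_sup av (K_embed av a) S \<le> r})"
    unfolding PK_open_ball_def by (intro disjI2 exI conjI) auto
  moreover have "P1_embed av z \<in> PK av - Some ` {S \<in> AK av. AK_sup av (K_embed av a) S \<le> r}
      \<longleftrightarrow> ereal r < P1_absdiff av a z" for z
    using K_embed_in_AK P1_embed_in_PK[of z]
    by (cases z) (auto simp: P1_embed_def AK_sup_K_embed av_diff_commute)
  ultimately show ?thesis using 2 by blast
qed

lemma corr_open_ball_eq:
  assumes "P1_open_ball av B \<or> P1_irrational_ball av B"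
  shows "corr_open_ball av B = {p \<in> PK av. filter_mem B (tree_filter av p)}"
proof -
  have eq: "\<B> = {p \<in> PK av. filter_mem B (tree_filter av p)}"
    if "PK_open_ball av \<B>" "P1_embed av -` \<B> = B" for \<B>
    using PK_open_ball_eq[OF that(1)] that(2) by simp
  obtain \<B> where "PK_open_ball av \<B>" "P1_embed av -` \<B> = B"
    using PK_open_ball_exists[OF assms] by blast
  then have "PK_open_ball av {p \<in> PK av. filter_mem B (tree_filter av p)}"
      "P1_embed av -` {p \<in> PK av. filter_mem B (tree_filter av p)} = B"
    using eq[of \<B>] by simp_all
  then show ?thesis
    unfolding corr_open_ball_def by (intro the_equality conjI) (simp_all only: eq)
qed

lemma PK_closed_ball_iff:
  "PK_closed_ball av \<B> \<longleftrightarrow> \<B> \<subseteq> PK av \<and> PK_open_ball av (PK av - \<B>)"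
proof -
  have sub: "Some ` \<D> \<subseteq> PK av" if "AK_open_ball av \<D> \<or> AK_closed_ball av \<D>" for \<D>
    using that by (auto simp: AK_open_ball_def AK_closed_ball_def PK_def)
  have "\<B> \<subseteq> PK av \<and> PK_open_ball av (PK av - \<B>)" if cl: "PK_closed_ball av \<B>"
  proof -
    from cl consider \<D> where "AK_closed_ball av \<D>" "\<B> = Some ` \<D>"
      | \<D> where "AK_open_ball av \<D>" "\<B> = PK av - Some ` \<D>"
      unfolding PK_closed_ball_def by blast
    then show ?thesis
    proof cases
      case (2 \<D>)
      then have "PK av - \<B> = Some ` \<D>" using sub[of \<D>] by blast
      then show ?thesis using 2 unfolding PK_open_ball_def by blast
    qed (use sub in \<open>auto simp: PK_open_ball_def\<close>)
  qed
  moreover have "PK_closed_ball av \<B>" if sub': "\<B> \<subseteq> PK av" and op: "PK_open_ball av (PK av - \<B>)"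
  proof -
    from op consider \<D> where "AK_open_ball av \<D>" "PK av - \<B> = Some ` \<D>"
      | \<D> where "AK_closed_ball av \<D>" "PK av - \<B> = PK av - Some ` \<D>"
      unfolding PK_open_ball_def by (elim disjE exE conjE)
    then show ?thesis
    proof cases
      case (1 \<D>)
      then have "\<B> = PK av - Some ` \<D>" using sub' by blast
      then show ?thesis using 1 unfolding PK_closed_ball_def by blast
    next
      case (2 \<D>)
      then have "\<B> = Some ` \<D>" using sub' sub[of \<D>] by blast
      then show ?thesis using 2 unfolding PK_closed_ball_def by blast
    qed
  qed
  ultimately show ?thesis by blast
qed

lemma corr_closed_ball_eq:
  assumes B: "P1_closed_ball av B \<or> P1_irrational_ball av B"
  shows "corr_closed_ball av B = {p \<in> PK av. \<not> filter_mem (- B) (tree_filter av p)}"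
proof -
  have "P1_open_ball av (- B) \<or> P1_irrational_ball av (- B)"
    using B by (metis P1_closed_ball_Compl P1_irrational_ball_Compl double_compl)
  then obtain \<A> where \<A>: "PK_open_ball av \<A>" "P1_embed av -` \<A> = - B"
    using PK_open_ball_exists by blast
  have \<A>_sub: "\<A> \<subseteq> PK av" using PK_open_ball_eq[OF \<A>(1)] by blast
  have trace: "P1_embed av -` (PK av - \<B>) = - (P1_embed av -` \<B>)" for \<B>
    using P1_embed_in_PK by auto
  have eq: "\<B> = {p \<in> PK av. \<not> filter_mem (- B) (tree_filter av p)}"
    if "PK_closed_ball av \<B>" "P1_embed av -` \<B> = B" for \<B>
  proof -
    have sub: "\<B> \<subseteq> PK av" and "PK_open_ball av (PK av - \<B>)"
      using that(1) by (simp_all add: PK_closed_ball_iff)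
    then have "PK av - \<B> = {p \<in> PK av. filter_mem (- B) (tree_filter av p)}"
      using PK_open_ball_eq[of "PK av - \<B>"] trace[of \<B>] that(2) by simp
    with sub show ?thesis by auto
  qed
  have "PK_closed_ball av (PK av - \<A>)" "P1_embed av -` (PK av - \<A>) = B"
    using \<A> \<A>_sub trace[of \<A>] by (auto simp: PK_closed_ball_iff double_diff)
  then have "PK_closed_ball av {p \<in> PK av. \<not> filter_mem (- B) (tree_filter av p)}"
      "P1_embed av -` {p \<in> PK av. \<not> filter_mem (- B) (tree_filter av p)} = B"
    using eq[of "PK av - \<A>"] by simp_all
  then show ?thesis
    unfolding corr_closed_ball_def by (intro the_equality conjI) (simp_all only: eq)
qed


section \<open>Families of closed balls\<close>

text \<open>A smallest ball \<open>D\<close> of \<open>K\<close> in the family lies in the other balls of \<open>K\<close>, and a point of \<open>D\<close> that is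
  generic with respect to the centres of the remaining, complementary balls avoids all the removed
  balls at once, because each of them can be avoided in \<open>D\<close>.\<close>

lemma closed_balls_Helly:
  assumes fin: "finite \<D>" and cl: "\<And>D. D \<in> \<D> \<Longrightarrow> P1_closed_ball av D"
    and meet: "\<And>D D'. D \<in> \<D> \<Longrightarrow> D' \<in> \<D> \<Longrightarrow> D \<inter> D' \<noteq> {}"
  shows "\<Inter>\<D> \<noteq> {}"
proof (cases "\<forall>D\<in>\<D>. None \<in> D")
  case True
  then show ?thesis by blast
next
  case False
  define \<K> where "\<K> = {D \<in> \<D>. None \<notin> D}"
  have "\<exists>a s. s \<in> value_group av \<and> D = {z. P1_absdiff av a z \<le> ereal s}" if "D \<in> \<K>" for D
    using cl[of D] that unfolding P1_closed_ball_iff \<K>_def by auto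
  then obtain cen rad where K: "\<And>D. D \<in> \<K> \<Longrightarrow> rad D \<in> value_group av"
    "\<And>D. D \<in> \<K> \<Longrightarrow> D = {z. P1_absdiff av (cen D) z \<le> ereal (rad D)}"
    by metis
  have "\<exists>b r. D = {z. ereal r \<le> P1_absdiff av b z}" if "D \<in> \<D> - \<K>" for D
    using cl[of D] that unfolding P1_closed_ball_iff \<K>_def by auto
  then obtain cen' rad' where K': "\<And>D. D \<in> \<D> - \<K> \<Longrightarrow> D = {z. ereal (rad' D) \<le> P1_absdiff av (cen' D) z}"
    by metis
  have "finite \<K>" "\<K> \<noteq> {}" using fin False by (auto simp: \<K>_def)
  then obtain D0 where D0: "D0 \<in> \<K>" "\<And>D. D \<in> \<K> \<Longrightarrow> rad D0 \<le> rad D"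
    using ex_min_if_finite[of "rad ` \<K>"] by (auto simp: not_less)
  have D0': "D0 \<in> \<D>" using D0(1) by (simp add: \<K>_def)
  obtain z where z: "av (z - cen D0) \<le> rad D0"
    "\<forall>b\<in>cen' ` (\<D> - \<K>). max (rad D0) (av (cen D0 - b)) \<le> av (z - b)"
    using generic_point[OF K(1)[OF D0(1)], of "cen' ` (\<D> - \<K>)"] fin by blast
  have "Some z \<in> D" if D: "D \<in> \<D>" for D
  proof -
    obtain y where y: "y \<in> D" "y \<in> D0" using meet[OF D D0'] by blast
    then have "y \<in> {z. P1_absdiff av (cen D0) z \<le> ereal (rad D0)}"
      using K(2)[OF D0(1)] by blast
    then obtain w where w: "y = Some w" "av (w - cen D0) \<le> rad D0"
      by (cases y) auto
    show ?thesis
    proof (cases "D \<in> \<K>")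
      case True
      have "av (w - cen D) \<le> rad D"
        using y(1) w(1) K(2)[OF True] by (metis P1_absdiff_simps(2) ereal_less_eq(3) mem_Collect_eq)
      moreover have "av (z - w) \<le> rad D0"
        using av_triangle[of z w "cen D0"] z(1) w(2) av_diff_commute[of w "cen D0"] by simp
      ultimately have "av (z - cen D) \<le> rad D"
        using av_triangle[of z "cen D" w] D0(2)[OF True] by simp
      then show ?thesis
        using K(2)[OF True] by (metis P1_absdiff_simps(2) ereal_less_eq(3) mem_Collect_eq)
    next
      case False
      then have D': "D \<in> \<D> - \<K>" using D by simp
      have "rad' D \<le> av (w - cen' D)"
        using y(1) w(1) K'[OF D'] by (metis P1_absdiff_simps(2) ereal_less_eq(3) mem_Collect_eq)
      moreover have "max (rad D0) (av (cen D0 - cen' D)) \<le> av (z - cen' D)"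
        using z(2) D' by blast
      ultimately have "rad' D \<le> av (z - cen' D)"
        using av_triangle[of w "cen' D" "cen D0"] w(2) by linarith
      then show ?thesis
        using K'[OF D'] by (metis P1_absdiff_simps(2) ereal_less_eq(3) mem_Collect_eq)
    qed
  qed
  then show ?thesis by blast
qed

lemma PK_dist_Some:
  assumes "S \<in> AK av" "T \<in> AK av"
  shows "PK_dist av (Some S) (Some T) =
    (let M = max 1 (AK_sup av (K_embed av 0) S); N = max 1 (AK_sup av (K_embed av 0) T)
     in AK_sup av S T / (M * N) - 1 / 2 * (AK_sup av S S / M\<^sup>2) - 1 / 2 * (AK_sup av T T / N\<^sup>2))"
  using assms by (simp add: AK_abs_eq_sup AK_diam_eq_sup Let_def)

lemma PK_dist_commute: "p \<in> PK av \<Longrightarrow> q \<in> PK av \<Longrightarrow> PK_dist av p q = PK_dist av q p"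
  by (elim PK_cases) (auto simp: PK_dist_Some AK_sup_commute Let_def mult.commute simp del: PK_dist.simps(1))

lemma PK_dist_self: "p \<in> PK av \<Longrightarrow> PK_dist av p p = 0"
  by (elim PK_cases) (auto simp: PK_dist_Some Let_def power2_eq_square simp del: PK_dist.simps(1))

text \<open>In the application \<open>d\<close>, \<open>m\<close> and \<open>d'\<close>, \<open>m'\<close> are the diameters and absolute values of two points with
  supremum \<open>\<sigma>\<close>. When \<open>M\<close> and \<open>N\<close> differ, the larger of them is \<open>\<sigma>\<close> and cancels in the first
  fraction; in every case at least half of \<open>\<sigma> - d\<close>, hence of \<open>r - s\<close>, survives up to scale.\<close>

lemma chordal_lower_bound:
  fixes d d' \<sigma> m m' r s R :: real
  defines "M \<equiv> max 1 m" and "N \<equiv> max 1 m'"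
  assumes d: "0 \<le> d" "d \<le> m" "d \<le> s" and d': "0 \<le> d'" "d' \<le> m'" "d' \<le> \<sigma>"
    and r: "s < r" "r \<le> \<sigma>" "r \<le> R" and R: "M \<le> R"
    and ultra: "\<sigma> \<le> max m m'" "m' \<le> max m \<sigma>" "m \<le> max m' \<sigma>"
  shows "(r - s) / (2 * R\<^sup>2) \<le> \<sigma> / (M * N) - 1 / 2 * (d / M\<^sup>2) - 1 / 2 * (d' / N\<^sup>2)"
proof -
  have MN: "1 \<le> M" "1 \<le> N" by (simp_all add: M_def N_def)
  have sq: "M\<^sup>2 \<le> R\<^sup>2" using MN R by (intro power_mono) auto
  have le: "(r - s) / R\<^sup>2 \<le> x / M\<^sup>2" if "r - s \<le> x" for x
    using that sq r(1) MN by (intro frac_le) auto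
  consider "M = N" | "M < N" | "N < M" by linarith
  then have "(r - s) / R\<^sup>2 \<le> 2 * (\<sigma> / (M * N)) - d / M\<^sup>2 - d' / N\<^sup>2"
  proof cases
    case 1
    have "(r - s) / R\<^sup>2 \<le> (2 * \<sigma> - d - d') / M\<^sup>2"
      by (rule le) (use d d' r in linarith)
    then show ?thesis using 1 by (simp add: power2_eq_square diff_divide_distrib)
  next
    case 2
    then have N: "N = m'" "\<sigma> = N" using ultra by (auto simp: M_def N_def)
    have "0 < r" using r d by linarith
    have "(r - s) / R\<^sup>2 \<le> (r - s) / (r * M)"
      using r MN R \<open>0 < r\<close> by (intro divide_left_mono) (auto simp: power2_eq_square intro!: mult_mono)
    also have "\<dots> = (1 - s / r) / M" using \<open>0 < r\<close> by (simp add: field_simps)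
    also have "\<dots> \<le> (1 - d / N) / M"
    proof -
      have "d / N \<le> s / r" using d r N \<open>0 < r\<close> by (intro frac_le) auto
      then show ?thesis using MN by (intro divide_right_mono) auto
    qed
    also have "\<dots> = (M - d) / (M * N) + (N - M) / (M * N)" using MN by (simp add: field_simps)
    also have "\<dots> \<le> (M - d) / (M * M) + (N - M) / (M * N)"
      using 2 MN d by (intro add_right_mono divide_left_mono mult_left_mono) (auto simp: M_def)
    also have "\<dots> = 2 / M - d / M\<^sup>2 - 1 / N" using MN by (simp add: field_simps power2_eq_square)
    also have "\<dots> \<le> 2 / M - d / M\<^sup>2 - d' / N\<^sup>2"
      using d' MN N by (simp add: power2_eq_square field_simps)
    finally show ?thesis using N MN by simp
  next
    case 3
    then have M: "M = m" "\<sigma> = M" using ultra by (auto simp: M_def N_def)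
    have "(r - s) / R\<^sup>2 \<le> (M - d) / M\<^sup>2"
      by (rule le) (use d r M in linarith)
    also have "\<dots> = 1 / M - d / M\<^sup>2" using MN by (simp add: field_simps power2_eq_square)
    also have "\<dots> \<le> 1 / N - d / M\<^sup>2" using 3 MN by (simp add: frac_le)
    also have "\<dots> \<le> 2 / N - d / M\<^sup>2 - d' / N\<^sup>2"
    proof -
      have "d' / N\<^sup>2 \<le> N / N\<^sup>2" using d' MN by (intro divide_right_mono) (auto simp: N_def)
      then show ?thesis using MN by (simp add: power2_eq_square)
    qed
    finally show ?thesis using M MN by simp
  qed
  moreover have "(r - s) / (2 * R\<^sup>2) = 1 / 2 * ((r - s) / R\<^sup>2)" by simp
  ultimately show ?thesis by linarith
qed

text \<open>This expresses that \<open>PK_absdiff av c\<close> is uniformly continuous on the tree, for the uniform structure of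
  the compact interval \<open>[0, \<infinity>]\<close>; all quantities in the lower bound stay controlled because
  \<open>sup{c, S} \<le> s\<close> confines \<open>S\<close> to a bounded part of the tree.\<close>

lemma PK_separation:
  assumes s: "0 \<le> s" "s < r"
  shows "\<exists>e>0. \<forall>p\<in>PK av. \<forall>q\<in>PK av.
    PK_absdiff av c p \<le> ereal s \<longrightarrow> ereal r \<le> PK_absdiff av c q \<longrightarrow> e \<le> PK_dist av p q"
proof -
  define R where "R = max 1 (max (av c) r)"
  have R: "1 \<le> R" "r \<le> R" "av c \<le> R" by (auto simp: R_def)
  have "(r - s) / (2 * R\<^sup>2) \<le> PK_dist av p q"
    if p: "p \<in> PK av" and q: "q \<in> PK av"
      and pc: "PK_absdiff av c p \<le> ereal s" and qc: "ereal r \<le> PK_absdiff av c q" for p q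
  proof -
    obtain S where S: "S \<in> AK av" "p = Some S" and Sc: "AK_sup av (K_embed av c) S \<le> s"
      using p pc by (auto elim: PK_cases)
    have Sdiam: "AK_sup av S S \<le> AK_sup av (K_embed av a) S" for a
      using AK_sup_self_le[OF S(1) K_embed_in_AK, of a] AK_sup_commute[OF S(1) K_embed_in_AK, of a] by simp
    have S0: "AK_sup av (K_embed av 0) S \<le> R"
      using AK_sup_K_ultra(1)[OF S(1), of 0 c] Sc s R by (simp add: av_minus)
    show ?thesis
      using q
    proof (cases rule: PK_cases)
      case 1
      define M where "M = max 1 (AK_sup av (K_embed av 0) S)"
      have M: "1 \<le> M" "M \<le> R" "AK_sup av S S \<le> M" using S0 R Sdiam[of 0] by (auto simp: M_def)
      have "(r - s) / (2 * R\<^sup>2) \<le> R / (2 * R\<^sup>2)" using R s by (intro divide_right_mono) auto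
      also have "\<dots> = 1 / (2 * R)" using R by (simp add: power2_eq_square)
      also have "\<dots> \<le> 1 / (2 * M)" using M by (simp add: frac_le)
      also have "\<dots> = 1 / M - 1 / 2 * (M / M\<^sup>2)" using M by (simp add: power2_eq_square field_simps)
      also have "\<dots> \<le> 1 / M - 1 / 2 * (AK_sup av S S / M\<^sup>2)"
        using M by (intro diff_left_mono mult_left_mono divide_right_mono) auto
      finally show ?thesis using 1 S by (simp add: AK_abs_eq_sup AK_diam_eq_sup M_def)
    next
      case (2 T)
      have T: "T \<in> AK av" "r \<le> AK_sup av (K_embed av c) T" using 2 qc by auto
      have "AK_sup av T T \<le> AK_sup av (K_embed av 0) T"
        using AK_sup_self_le[OF T(1) K_embed_in_AK, of 0] AK_sup_commute[OF T(1) K_embed_in_AK, of 0] by simp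
      moreover have "AK_sup av T T \<le> AK_sup av S T"
        using AK_sup_self_le[OF T(1) S(1)] AK_sup_commute[OF T(1) S(1)] by simp
      moreover have "r \<le> AK_sup av S T"
        using AK_sup_ultra[OF K_embed_in_AK S(1) T(1), of c] T(2) Sc s by auto
      moreover have "AK_sup av S T \<le> max (AK_sup av (K_embed av 0) S) (AK_sup av (K_embed av 0) T)"
        using AK_sup_ultra[OF S(1) K_embed_in_AK T(1), of 0] AK_sup_commute[OF S(1) K_embed_in_AK, of 0] by simp
      moreover have "AK_sup av (K_embed av 0) T \<le> max (AK_sup av (K_embed av 0) S) (AK_sup av S T)"
        by (rule AK_sup_ultra[OF K_embed_in_AK S(1) T(1)])
      moreover have "AK_sup av (K_embed av 0) S \<le> max (AK_sup av (K_embed av 0) T) (AK_sup av S T)"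
        using AK_sup_ultra[OF K_embed_in_AK T(1) S(1), of 0] AK_sup_commute[OF S(1) T(1)] by simp
      ultimately show ?thesis
        unfolding 2 S(2) PK_dist_Some[OF S(1) T(1)] Let_def
        using Sdiam[of 0] Sdiam[of c] Sc s R S0 AK_sup_nonneg S(1) T(1)
        by (intro chordal_lower_bound) auto
    qed
  qed
  moreover have "0 < (r - s) / (2 * R\<^sup>2)" using s R by auto
  ultimately show ?thesis by blast
qed

lemma disjoint_closed_balls_separated:
  assumes D: "P1_closed_ball av D" and D': "P1_closed_ball av D'" and disj: "D \<inter> D' = {}"
  shows "\<exists>e>0. \<forall>p\<in>PK av. \<forall>q\<in>PK av. \<not> filter_mem (- D) (tree_filter av p) \<longrightarrow>
    \<not> filter_mem (- D') (tree_filter av q) \<longrightarrow> e \<le> PK_dist av p q"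
proof -
  have mixed: "\<exists>e>0. \<forall>p\<in>PK av. \<forall>q\<in>PK av. PK_absdiff av a p \<le> ereal s \<longrightarrow>
      ereal r \<le> PK_absdiff av b q \<longrightarrow> e \<le> PK_dist av p q"
    if s: "s \<in> value_group av"
      and disj: "{z. P1_absdiff av a z \<le> ereal s} \<inter> {z. ereal r \<le> P1_absdiff av b z} = {}" for a b s r
  proof -
    obtain z where z: "av (z - a) \<le> s" "max s (av (a - b)) \<le> av (z - b)"
      using generic_point[OF s, of "{b}" a] by auto
    have "Some z \<notin> {z. P1_absdiff av a z \<le> ereal s} \<inter> {z. ereal r \<le> P1_absdiff av b z}"
      using disj by blast
    then have less: "max s (av (a - b)) < r" using z by auto
    have "PK_absdiff av b p \<le> ereal (max s (av (a - b)))"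
      if "p \<in> PK av" "PK_absdiff av a p \<le> ereal s" for p
      using that(1)
    proof (cases rule: PK_cases)
      case (2 S)
      then show ?thesis
        using AK_sup_K_ultra(1)[of S b a] that(2) av_diff_commute[of a b]
        by (simp del: ereal_max)
    qed (use that(2) in simp)
    moreover have "0 \<le> max s (av (a - b))" using value_group_pos[OF s] by simp
    ultimately show ?thesis
      using PK_separation[of "max s (av (a - b))" r b] less by blast
  qed
  have not_less: "\<not> filter_mem (- {z. P1_absdiff av a z \<le> r}) (tree_filter av p) \<longleftrightarrow> PK_absdiff av a p \<le> r"
    "\<not> filter_mem (- {z. r \<le> P1_absdiff av a z}) (tree_filter av p) \<longleftrightarrow> r \<le> PK_absdiff av a p"
    if "p \<in> PK av" for a r p
    using tree_filter_greater_iff[OF that, of r a] tree_filter_less_iff[OF that, of a r]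
    by (simp_all add: Collect_neg_eq[symmetric] not_le not_less)
  from D D' obtain a s b r where s: "s \<in> value_group av" and r: "r \<in> value_group av"
    and "D = {z. P1_absdiff av a z \<le> ereal s} \<or> D = {z. ereal s \<le> P1_absdiff av a z}"
      "D' = {z. P1_absdiff av b z \<le> ereal r} \<or> D' = {z. ereal r \<le> P1_absdiff av b z}"
    unfolding P1_closed_ball_iff by metis
  then consider
      (KK) "D = {z. P1_absdiff av a z \<le> ereal s}" "D' = {z. P1_absdiff av b z \<le> ereal r}"
    | (KC) "D = {z. P1_absdiff av a z \<le> ereal s}" "D' = {z. ereal r \<le> P1_absdiff av b z}"
    | (CK) "D = {z. ereal s \<le> P1_absdiff av a z}" "D' = {z. P1_absdiff av b z \<le> ereal r}"
    | (CC) "D = {z. ereal s \<le> P1_absdiff av a z}" "D' = {z. ereal r \<le> P1_absdiff av b z}"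
    by metis
  then show ?thesis
  proof cases
    case KK
    have "Some a \<in> D" "Some b \<in> D'"
      using KK value_group_pos[OF r] value_group_pos[OF s] by simp_all
    then have "Some b \<notin> D" "Some a \<notin> D'"
      using disj by blast+
    then have less: "s < av (b - a)" "r < av (b - a)"
      using KK av_diff_commute[of a b] by auto
    have "ereal (av (b - a)) \<le> PK_absdiff av a q"
      if "q \<in> PK av" "PK_absdiff av b q \<le> ereal r" for q
      using that(1)
    proof (cases rule: PK_cases)
      case (2 S)
      then show ?thesis
        using AK_sup_K_ultra(2)[of S b a] that(2) less by auto
    qed simp
    moreover have "0 \<le> s" using value_group_pos[OF s] by simp
    ultimately show ?thesis
      using PK_separation[of s "av (b - a)" a] less not_less unfolding KK by metis
  next
    case KC
    then show ?thesis using mixed[OF s, of a r b] disj not_less by metis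
  next
    case CK
    then obtain e where "e > 0" "\<forall>p\<in>PK av. \<forall>q\<in>PK av. PK_absdiff av b p \<le> ereal r \<longrightarrow>
        ereal s \<le> PK_absdiff av a q \<longrightarrow> e \<le> PK_dist av p q"
      using mixed[OF r, of b s a] disj by blast
    then show ?thesis unfolding CK using not_less PK_dist_commute by metis
  next
    case CC
    then have "None \<in> D \<inter> D'" by simp
    then show ?thesis using disj by simp
  qed
qed


section \<open>Lebesgue numbers of affinoid covers\<close>

lemma filter_mem_mono: "filter_mem A F \<Longrightarrow> A \<subseteq> B \<Longrightarrow> filter_mem B F"
  unfolding filter_mem_def by (erule eventually_mono) auto

lemma filter_mem_Inter:
  "finite \<B> \<Longrightarrow> (\<And>B. B \<in> \<B> \<Longrightarrow> filter_mem B F) \<Longrightarrow> filter_mem (\<Inter>\<B>) F"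
  by (simp add: filter_mem_def eventually_ball_finite)

text \<open>If no member of the cover belonged to both filters, each member would have a defining ball
  missing from one of them. The complements of these balls have no common point, so two of them are
  disjoint; as both cannot be met by the same filter, \<open>p\<close> and \<open>q\<close> are as far apart as these two.\<close>

lemma affinoid_cover_Lebesgue_number:
  assumes C: "C \<in> affinoid_covers av"
  shows "\<exists>e>0. \<forall>p\<in>PK av. \<forall>q\<in>PK av. PK_dist av p q < e \<longrightarrow>
    (\<exists>Y\<in>C. filter_mem Y (tree_filter av p) \<and> filter_mem Y (tree_filter av q))"
proof -
  have finC: "finite C" and cover: "\<Union>C = UNIV" using C by (auto simp: affinoid_covers_def)
  have "\<forall>Y\<in>C. \<exists>\<B>. finite \<B> \<and> (\<forall>B\<in>\<B>. P1_open_ball av B) \<and> \<Inter>\<B> = Y"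
    using C by (auto simp: affinoid_covers_def open_affinoid_def)
  then obtain bs where bs: "\<And>Y. Y \<in> C \<Longrightarrow> finite (bs Y)"
    "\<And>Y B. Y \<in> C \<Longrightarrow> B \<in> bs Y \<Longrightarrow> P1_open_ball av B" "\<And>Y. Y \<in> C \<Longrightarrow> \<Inter>(bs Y) = Y"
    by metis
  define \<D> where "\<D> = (\<Union>Y\<in>C. uminus ` bs Y)"
  have \<D>: "finite \<D>" "\<And>D. D \<in> \<D> \<Longrightarrow> P1_closed_ball av D"
    using finC bs by (auto simp: \<D>_def P1_closed_ball_Compl)
  define P where "P = {(D, D'). D \<in> \<D> \<and> D' \<in> \<D> \<and> D \<inter> D' = {}}"
  have "finite P" using \<D>(1) by (intro finite_subset[of P "\<D> \<times> \<D>"]) (auto simp: P_def)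
  have "\<forall>x\<in>P. \<exists>e>0. \<forall>p\<in>PK av. \<forall>q\<in>PK av. \<not> filter_mem (- fst x) (tree_filter av p) \<longrightarrow>
      \<not> filter_mem (- snd x) (tree_filter av q) \<longrightarrow> e \<le> PK_dist av p q"
    using disjoint_closed_balls_separated \<D>(2) by (auto simp: P_def)
  then obtain \<epsilon> where \<epsilon>: "\<And>x. x \<in> P \<Longrightarrow> \<epsilon> x > 0"
    "\<And>x p q. x \<in> P \<Longrightarrow> p \<in> PK av \<Longrightarrow> q \<in> PK av \<Longrightarrow> \<not> filter_mem (- fst x) (tree_filter av p) \<Longrightarrow>
      \<not> filter_mem (- snd x) (tree_filter av q) \<Longrightarrow> \<epsilon> x \<le> PK_dist av p q"
    by metis
  define e where "e = Min (insert 1 (\<epsilon> ` P))"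
  have e: "e > 0" "\<And>x. x \<in> P \<Longrightarrow> e \<le> \<epsilon> x"
    using \<open>finite P\<close> \<epsilon>(1) by (auto simp: e_def Min_gr_iff Min_le_iff)
  have "\<exists>Y\<in>C. filter_mem Y (tree_filter av p) \<and> filter_mem Y (tree_filter av q)"
    if p: "p \<in> PK av" and q: "q \<in> PK av" and near: "PK_dist av p q < e" for p q
  proof (rule ccontr)
    assume "\<not> ?thesis"
    then have "\<forall>Y\<in>C. \<exists>B\<in>bs Y. \<not> filter_mem B (tree_filter av p) \<or> \<not> filter_mem B (tree_filter av q)"
      using filter_mem_Inter bs(1,3) by metis
    then obtain b where b: "\<And>Y. Y \<in> C \<Longrightarrow> b Y \<in> bs Y"
      "\<And>Y. Y \<in> C \<Longrightarrow> \<not> filter_mem (b Y) (tree_filter av p) \<or> \<not> filter_mem (b Y) (tree_filter av q)"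
      by metis
    have empty: "\<Inter>((\<lambda>Y. - b Y) ` C) = {}"
    proof -
      have "z \<notin> \<Inter>((\<lambda>Y. - b Y) ` C)" for z
      proof -
        have "z \<in> \<Union>C" using cover by simp
        then obtain Y where "Y \<in> C" "z \<in> Y" by (rule UnionE)
        then have "z \<in> b Y" using b(1)[of Y] bs(3)[of Y] by blast
        then show ?thesis using \<open>Y \<in> C\<close> by auto
      qed
      then show ?thesis by blast
    qed
    have closed: "P1_closed_ball av (- b Y)" if "Y \<in> C" for Y
      using that b(1) by (intro \<D>(2)) (auto simp: \<D>_def)
    have "\<exists>Y\<in>C. \<exists>Z\<in>C. - b Y \<inter> - b Z = {}"
    proof (rule ccontr)
      assume "\<not> ?thesis"
      then have "\<Inter>((\<lambda>Y. - b Y) ` C) \<noteq> {}"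
        using finC closed by (intro closed_balls_Helly) (auto simp del: Compl_Un)
      then show False using empty by simp
    qed
    then obtain Y Z where YZ: "Y \<in> C" "Z \<in> C" "- b Y \<inter> - b Z = {}"
      by blast
    have P: "(- b Y, - b Z) \<in> P" "(- b Z, - b Y) \<in> P"
      using YZ b(1) by (auto simp: P_def \<D>_def)
    have self: "0 < PK_dist av x x"
      if "x \<in> PK av" "\<not> filter_mem (b Y) (tree_filter av x)" "\<not> filter_mem (b Z) (tree_filter av x)" for x
      using \<epsilon>(2)[OF P(1) that(1,1)] that \<epsilon>(1)[OF P(1)] by simp
    have "e \<le> PK_dist av p q"
      if "\<not> filter_mem (b Y) (tree_filter av p)" "\<not> filter_mem (b Z) (tree_filter av q)"
      using \<epsilon>(2)[OF P(1) p q] that e(2)[OF P(1)] by simp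
    moreover have "e \<le> PK_dist av p q"
      if "\<not> filter_mem (b Z) (tree_filter av p)" "\<not> filter_mem (b Y) (tree_filter av q)"
      using \<epsilon>(2)[OF P(2) p q] that e(2)[OF P(2)] by simp
    ultimately show False
      using b(2)[OF YZ(1)] b(2)[OF YZ(2)] self[OF p] self[OF q] PK_dist_self[OF p] PK_dist_self[OF q]
        near by linarith
  qed
  then show ?thesis using e(1) by blast
qed

lemma P1_cauchy_tree_filter:
  assumes p: "p \<in> PK av"
  shows "P1_cauchy av (tree_filter av p)"
  unfolding P1_cauchy_def
proof (intro conjI ballI)
  show "tree_filter av p \<noteq> bot" using tree_filter_ne_bot[OF p] .
  fix V assume "V \<in> P1_uniformity av"
  then obtain C where C: "C \<in> affinoid_covers av" "cover_entourage C \<subseteq> V"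
    by (auto simp: P1_uniformity_def)
  obtain Y where "Y \<in> C" "filter_mem Y (tree_filter av p)"
    using affinoid_cover_Lebesgue_number[OF C(1)] p PK_dist_self[OF p] by metis
  then show "\<exists>Y. filter_mem Y (tree_filter av p) \<and> Y \<times> Y \<subseteq> V"
    using C(2) unfolding cover_entourage_def by blast
qed


section \<open>Every Cauchy filter refines the filter of a point of the tree\<close>

lemma two_ball_cover:
  assumes "s \<in> value_group av" "r \<in> value_group av" "s < r"
  shows "{{z. P1_absdiff av c z < ereal r}, {z. ereal s < P1_absdiff av c z}} \<in> affinoid_covers av"
proof -
  have "open_affinoid av B" if "P1_open_ball av B" for B
    using that unfolding open_affinoid_def by (intro exI[of _ "{B}"]) auto
  then show ?thesis
    using assms by (auto simp: affinoid_covers_def P1_open_ball_iff not_less intro: le_less_trans)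
qed

lemma small_for_two_sets:
  "Y \<times> Y \<subseteq> cover_entourage {A, B} \<Longrightarrow> Y \<subseteq> A \<or> Y \<subseteq> B"
  unfolding cover_entourage_def by blast

lemma cauchy_dichotomy:
  assumes F: "P1_cauchy av F" and sr: "s \<in> value_group av" "r \<in> value_group av" "s < r"
  shows "(\<forall>\<^sub>F z in F. P1_absdiff av c z < ereal r) \<or> (\<forall>\<^sub>F z in F. ereal s < P1_absdiff av c z)"
proof -
  have "cover_entourage {{z. P1_absdiff av c z < ereal r}, {z. ereal s < P1_absdiff av c z}} \<in> P1_uniformity av"
    using two_ball_cover[OF sr] by (auto simp: P1_uniformity_def)
  then obtain Y where Y: "filter_mem Y F"
    "Y \<times> Y \<subseteq> cover_entourage {{z. P1_absdiff av c z < ereal r}, {z. ereal s < P1_absdiff av c z}}"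
    using F unfolding P1_cauchy_def by blast
  show ?thesis
    using small_for_two_sets[OF Y(2)] filter_mem_mono[OF Y(1)]
    unfolding filter_mem_def by (metis (mono_tags, lifting) eventually_mono mem_Collect_eq)
qed

lemma P1_absdiff_nonneg: "0 \<le> P1_absdiff av c z"
  by (cases z) (auto simp: av_nonneg)

text \<open>Below its upper limit \<open>l\<close> the function cannot oscillate: for values \<open>s < r < l\<close> it is not eventually
  smaller than \<open>r\<close>, so the dichotomy makes it eventually larger than \<open>s\<close>.\<close>

lemma cauchy_absdiff_convergent:
  assumes F: "P1_cauchy av F"
  shows "\<exists>l. (P1_absdiff av c \<longlongrightarrow> l) F"
proof -
  define l where "l = Limsup F (P1_absdiff av c)"
  have "(P1_absdiff av c \<longlongrightarrow> l) F"
  proof (rule order_tendstoI)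
    fix u assume "u < l"
    show "\<forall>\<^sub>F z in F. u < P1_absdiff av c z"
    proof (cases "u < 0")
      case True
      then show ?thesis
        by (intro always_eventually allI) (use P1_absdiff_nonneg in \<open>blast intro: less_le_trans\<close>)
    next
      case False
      obtain t where t: "u < ereal t" "ereal t < l" using ereal_dense2[OF \<open>u < l\<close>] by blast
      obtain x where x: "u = ereal x" using False t by (cases u) auto
      have "0 \<le> x" "x < t" using x False t by (auto simp: zero_ereal_def)
      then obtain r where r: "r \<in> value_group av" "x < r" "r < t"
        using value_group_dense by blast
      then obtain s where s: "s \<in> value_group av" "x < s" "s < r"
        using value_group_dense \<open>0 \<le> x\<close> by blast
      have "\<not> (\<forall>\<^sub>F z in F. P1_absdiff av c z < ereal r)"
      proof
        assume "\<forall>\<^sub>F z in F. P1_absdiff av c z < ereal r"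
        then have "l \<le> ereal r" unfolding l_def by (intro Limsup_bounded) (auto elim: eventually_mono)
        then have "l < ereal t" using r by (auto intro: le_less_trans)
        then show False using t(2) by simp
      qed
      then have "\<forall>\<^sub>F z in F. ereal s < P1_absdiff av c z"
        using cauchy_dichotomy[OF F s(1) r(1) s(3)] by blast
      moreover have "u < ereal s" using x s by simp
      ultimately show ?thesis by (auto elim!: eventually_mono)
    qed
  next
    fix u assume "l < u"
    then show "\<forall>\<^sub>F z in F. P1_absdiff av c z < u"
      unfolding l_def by (rule Limsup_lessD)
  qed
  then show ?thesis by blast
qed

text \<open>The ultrametric inequalities pass to the limits of \<open>|z - c|\<close>. They make one infinite limit force all
  to be infinite, and otherwise they are what a point of the tree needs.\<close>

lemma cauchy_le_tree_filter:
  assumes F: "P1_cauchy av F"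
  shows "\<exists>p\<in>PK av. F \<le> tree_filter av p"
proof -
  have nb: "F \<noteq> bot" using F by (simp add: P1_cauchy_def)
  obtain l where l: "\<And>c. (P1_absdiff av c \<longlongrightarrow> l c) F"
    using cauchy_absdiff_convergent[OF F] by metis
  have ultra: "P1_absdiff av a z \<le> max (ereal (av (a - b))) (P1_absdiff av b z)"
    and sep: "ereal (av (a - b)) \<le> max (P1_absdiff av a z) (P1_absdiff av b z)" for a b z
    using av_triangle[of _ a b] av_triangle[of a b] av_diff_commute[of a]
    by (cases z; auto simp: max.commute simp del: ereal_max simp flip: ereal_max)+
  have l_nonneg: "0 \<le> l c" for c
    using tendsto_lowerbound[OF l _ nb] P1_absdiff_nonneg by simp
  have l_ultra: "l a \<le> max (ereal (av (a - b))) (l b)" for a b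
    by (rule tendsto_le[OF nb tendsto_max[OF tendsto_const l] l]) (simp add: ultra)
  have l_sep: "ereal (av (a - b)) \<le> max (l a) (l b)" for a b
    by (rule tendsto_le[OF nb tendsto_max[OF l l] tendsto_const]) (simp add: sep)
  show ?thesis
  proof (cases "\<exists>c. l c = \<infinity>")
    case True
    then obtain c where "l c = \<infinity>" by blast
    then have "l b = \<infinity>" for b
      using l_ultra[of c b] by (auto simp: max_def split: if_splits)
    then have "F \<le> tree_filter av None" using l by (simp add: le_tree_filter_iff)
    then show ?thesis by (auto simp: PK_def)
  next
    case False
    then have "\<exists>x. l c = ereal x" for c using l_nonneg[of c] by (cases "l c") auto
    then obtain \<phi> where \<phi>: "\<And>c. l c = ereal (\<phi> c)" by metis
    have "0 \<le> \<phi> a" "\<phi> a \<le> max (av (a - b)) (\<phi> b)" "av (a - b) \<le> max (\<phi> a) (\<phi> b)" for a b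
      using l_nonneg[of a] l_ultra[of a b] l_sep[of a b]
      by (simp_all add: \<phi> flip: ereal_max)
    then obtain S where S: "S \<in> AK av" "\<And>c. AK_sup av (K_embed av c) S = \<phi> c"
      using AK_point_of_distances[of \<phi>] by blast
    then have "F \<le> tree_filter av (Some S)" using l by (simp add: le_tree_filter_iff \<phi>)
    then show ?thesis using S(1) by (auto simp: PK_def)
  qed
qed

lemma tree_filter_in_Phat:
  assumes p: "p \<in> PK av"
  shows "tree_filter av p \<in> Phat av"
  unfolding Phat_def
proof (intro CollectI conjI allI impI)
  show "P1_cauchy av (tree_filter av p)" using p by (rule P1_cauchy_tree_filter)
  fix G assume G: "P1_cauchy av G \<and> tree_filter av p \<le> G"
  then obtain q where q: "q \<in> PK av" "G \<le> tree_filter av q" using cauchy_le_tree_filter by blast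
  then have "p = q" using tree_filter_le_imp_eq[OF p q(1)] G by (blast intro: order_trans)
  then show "G = tree_filter av p" using q G by simp
qed

lemma bij_betw_tree_filter: "bij_betw (tree_filter av) (PK av) (Phat av)"
proof (rule bij_betw_imageI)
  show "inj_on (tree_filter av) (PK av)"
    by (rule inj_onI) (simp add: tree_filter_le_imp_eq)
  have "F \<in> tree_filter av ` PK av" if "F \<in> Phat av" for F
  proof -
    have "P1_cauchy av F" "\<And>G. P1_cauchy av G \<Longrightarrow> F \<le> G \<Longrightarrow> G = F"
      using that by (auto simp: Phat_def)
    then show ?thesis using cauchy_le_tree_filter P1_cauchy_tree_filter by (metis image_eqI)
  qed
  then show "tree_filter av ` PK av = Phat av" using tree_filter_in_Phat by blast
qed

lemma uniformly_continuous_tree_filter: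
  "uniformly_continuous_into (PK av) (PK_dist av) (Phat_uniformity av) (tree_filter av)"
  unfolding uniformly_continuous_into_def
proof
  fix E assume "E \<in> Phat_uniformity av"
  then obtain V C where V: "common_small av V \<subseteq> E" and C: "C \<in> affinoid_covers av" "cover_entourage C \<subseteq> V"
    by (auto simp: Phat_uniformity_def P1_uniformity_def)
  obtain e where "e > 0" and e: "\<And>p q. p \<in> PK av \<Longrightarrow> q \<in> PK av \<Longrightarrow> PK_dist av p q < e \<Longrightarrow>
      \<exists>Y\<in>C. filter_mem Y (tree_filter av p) \<and> filter_mem Y (tree_filter av q)"
    using affinoid_cover_Lebesgue_number[OF C(1)] by blast
  have "(tree_filter av p, tree_filter av q) \<in> E"
    if pq: "p \<in> PK av" "q \<in> PK av" "PK_dist av p q < e" for p q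
  proof -
    obtain Y where "Y \<in> C" "filter_mem Y (tree_filter av p)" "filter_mem Y (tree_filter av q)"
      using e[OF pq] by blast
    moreover from this have "Y \<times> Y \<subseteq> V" using C(2) by (auto simp: cover_entourage_def)
    ultimately show ?thesis
      using V pq tree_filter_in_Phat by (auto simp: common_small_def)
  qed
  then show "\<exists>e>0. \<forall>p\<in>PK av. \<forall>q\<in>PK av. PK_dist av p q < e \<longrightarrow> (tree_filter av p, tree_filter av q) \<in> E"
    using \<open>e > 0\<close> by blast
qed


section \<open>Points of the projective line\<close>

lemma P1_dist_simps:
  "P1_dist av (Some x) (Some y) = av (x - y) / (max (av x) 1 * max (av y) 1)"
  "P1_dist av (Some x) None = 1 / max (av x) 1"
  "P1_dist av None (Some y) = 1 / max (av y) 1"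
  "P1_dist av None None = 0"
  by (simp_all add: P1_dist_def av_1 av_minus av_nonneg max_def)

text \<open>For the triangle inequality, let \<open>u = (x, y)\<close>, \<open>v = (x', y')\<close>, \<open>w = (x'', y'')\<close> be homogeneous
  coordinates; then \<open>(u \<and> w) v = (u \<and> v) w + (v \<and> w) u\<close>, where \<open>\<and>\<close> denotes the determinant.\<close>

lemma Metric_space_P1: "Metric_space UNIV (P1_dist av)"
proof
  fix p q :: "'k option"
  show "0 \<le> P1_dist av p q"
    by (cases p; cases q) (auto simp: P1_dist_simps av_nonneg intro!: divide_nonneg_pos mult_pos_pos)
  show "P1_dist av p q = P1_dist av q p"
    by (cases p; cases q) (auto simp: P1_dist_simps av_diff_commute mult.commute)
  show "P1_dist av p q = 0 \<longleftrightarrow> p = q"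
    by (cases p; cases q) (auto simp: P1_dist_simps av_eq_0_iff max_def)
next
  fix p q r :: "'k option"
  define n where "n u = (case u of (x, y) \<Rightarrow> max (av x) (av y))" for u :: "'k \<times> 'k"
  define det where "det u v = (case (u, v) of ((x, y), (x', y')) \<Rightarrow> x * y' - y * x')" for u v :: "'k \<times> 'k"
  have pos: "0 < n (P1_coords p)" for p
    by (cases p) (auto simp: n_def av_1 less_max_iff_disj)
  have dist: "P1_dist av p q = av (det (P1_coords p) (P1_coords q)) / (n (P1_coords p) * n (P1_coords q))" for p q
    by (simp add: P1_dist_def n_def det_def split_beta)
  have det_le: "av (det u w) * n v \<le> av (det u v) * n w + av (det v w) * n u" for u v w
  proof -
    obtain x y x' y' x'' y'' where uvw: "u = (x, y)" "v = (x', y')" "w = (x'', y'')"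
      by (metis surj_pair)
    have "det u w * x' = det u v * x'' + det v w * x" "det u w * y' = det u v * y'' + det v w * y"
      by (simp_all add: det_def uvw algebra_simps)
    then have "av (det u w) * av x' \<le> max (av (det u v) * av x'') (av (det v w) * av x)"
      "av (det u w) * av y' \<le> max (av (det u v) * av y'') (av (det v w) * av y)"
      by (metis av_add av_mult)+
    moreover have "av (det u v) * av x'' \<le> av (det u v) * n w" "av (det u v) * av y'' \<le> av (det u v) * n w"
      "av (det v w) * av x \<le> av (det v w) * n u" "av (det v w) * av y \<le> av (det v w) * n u"
      by (auto simp: n_def uvw av_nonneg intro!: mult_left_mono)
    moreover have "0 \<le> av (det u v) * n w" "0 \<le> av (det v w) * n u"
      using av_nonneg by (auto simp: n_def uvw le_max_iff_disj)
    moreover have "av (det u w) * n v = max (av (det u w) * av x') (av (det u w) * av y')"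
      by (simp add: n_def uvw max_mult_distrib_left av_nonneg)
    ultimately show ?thesis by linarith
  qed
  let ?u = "P1_coords p" and ?v = "P1_coords q" and ?w = "P1_coords r"
  have "P1_dist av p r = av (det ?u ?w) * n ?v / (n ?u * n ?v * n ?w)"
    using pos[of q] by (simp add: dist)
  also have "\<dots> \<le> (av (det ?u ?v) * n ?w + av (det ?v ?w) * n ?u) / (n ?u * n ?v * n ?w)"
    using pos[of p] pos[of q] pos[of r] by (intro divide_right_mono det_le) auto
  also have "\<dots> = P1_dist av p q + P1_dist av q r"
    using pos[of p] pos[of q] pos[of r] by (simp add: dist field_simps)
  finally show "P1_dist av p r \<le> P1_dist av p q + P1_dist av q r" .
qed

lemma eventually_P1_point:
  "eventually P (P1_point av z) \<longleftrightarrow> (\<exists>e>0. \<forall>w. P1_dist av z w < e \<longrightarrow> P w)"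
proof -
  interpret P1: Metric_space UNIV "P1_dist av" by (rule Metric_space_P1)
  have "eventually P (P1_point av z) \<longleftrightarrow> (\<exists>S. openin P1.mtopology S \<and> z \<in> S \<and> (\<forall>x\<in>S. P x))"
    by (simp add: P1_point_def P1_topology_def eventually_nhdsin)
  also have "\<dots> \<longleftrightarrow> (\<exists>e>0. \<forall>w\<in>P1.mball z e. P w)"
  proof
    assume "\<exists>S. openin P1.mtopology S \<and> z \<in> S \<and> (\<forall>x\<in>S. P x)"
    then show "\<exists>e>0. \<forall>w\<in>P1.mball z e. P w"
      unfolding P1.openin_mtopology by (meson subsetD)
  next
    assume "\<exists>e>0. \<forall>w\<in>P1.mball z e. P w"
    then obtain e where "e > 0" "\<forall>w\<in>P1.mball z e. P w" by blast
    then show "\<exists>S. openin P1.mtopology S \<and> z \<in> S \<and> (\<forall>x\<in>S. P x)"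
      by (intro exI[of _ "P1.mball z e"]) (simp add: P1.openin_mball)
  qed
  finally show ?thesis by (simp only: P1.in_mball UNIV_I simp_thms Ball_def)
qed

lemma P1_point_eq_tree_filter: "P1_point av z = tree_filter av (P1_embed av z)"
proof (rule antisym)
  show "P1_point av z \<le> tree_filter av (P1_embed av z)"
    unfolding le_tree_filter_iff PK_absdiff_P1_embed
  proof
    fix c
    show "(P1_absdiff av c \<longlongrightarrow> P1_absdiff av c z) (P1_point av z)"
    proof (cases z)
      case None
      have "\<forall>\<^sub>F w in P1_point av z. ereal r < P1_absdiff av c w" for r
        unfolding eventually_P1_point
      proof (intro exI[of _ "1 / max 1 (max \<bar>r\<bar> (av c) + 1)"] conjI allI impI)
        show "0 < 1 / max 1 (max \<bar>r\<bar> (av c) + 1)" by simp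
        fix w assume w: "P1_dist av z w < 1 / max 1 (max \<bar>r\<bar> (av c) + 1)"
        show "ereal r < P1_absdiff av c w"
        proof (cases w)
          case (Some y)
          have "1 / max (av y) 1 < 1 / max 1 (max \<bar>r\<bar> (av c) + 1)"
            using w None Some by (simp add: P1_dist_simps)
          then have "max 1 (max \<bar>r\<bar> (av c) + 1) < max (av y) 1"
            by (simp add: frac_less2 field_simps less_max_iff_disj max_def split: if_splits)
          then have "max \<bar>r\<bar> (av c) < av y" by linarith
          moreover have "av y \<le> max (av (y - c)) (av c)" using av_triangle[of y 0 c] by simp
          ultimately have "r < av (y - c)" by linarith
          then show ?thesis using Some by simp
        qed simp
      qed
      then show ?thesis using None by (simp add: tendsto_PInfty)
    next
      case (Some x)
      have near: "\<forall>\<^sub>F w in P1_point av z. \<exists>y. w = Some y \<and> av (x - y) < e" if e: "e > 0" for e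
        unfolding eventually_P1_point
      proof (intro exI[of _ "min (1 / max (av x) 1) (e / (max (av x) 1)\<^sup>2)"] conjI allI impI)
        \<comment> \<open>The first bound forces \<open>|y| \<le> M\<close>; then \<open>|x - y|\<close> is at most \<open>M\<^sup>2\<close> times the distance.\<close>
        let ?M = "max (av x) 1"
        show "0 < min (1 / ?M) (e / ?M\<^sup>2)" using e by (auto intro!: divide_pos_pos)
        fix w assume "P1_dist av z w < min (1 / ?M) (e / ?M\<^sup>2)"
        then have w: "P1_dist av (Some x) w < 1 / ?M" "P1_dist av (Some x) w < e / ?M\<^sup>2"
          using Some by auto
        then obtain y where y: "w = Some y" by (cases w) (auto simp: P1_dist_simps)
        have "max (av y) 1 \<le> ?M"
        proof (rule ccontr)
          assume "\<not> ?thesis"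
          then have less: "?M < av y" by linarith
          then have "av (x - y) = av y"
            using av_triangle[of y 0 x] av_triangle[of x y 0] av_diff_commute[of x y] by (auto simp: av_minus)
          moreover have "max (av y) 1 = av y" "av y \<noteq> 0" using less by auto
          ultimately have "P1_dist av (Some x) w = 1 / ?M" by (simp add: y P1_dist_simps)
          then show False using w by simp
        qed
        then have "av (x - y) / (?M * ?M) \<le> P1_dist av (Some x) w"
          unfolding y P1_dist_simps
          by (intro divide_left_mono mult_left_mono mult_pos_pos) (auto simp: av_nonneg)
        also have "\<dots> < e / ?M\<^sup>2" by (rule w)
        finally have "av (x - y) < e" by (simp add: power2_eq_square divide_less_cancel)
        then show "\<exists>y. w = Some y \<and> av (x - y) < e" using y by blast
      qed
      have "((\<lambda>w. av (the w - c)) \<longlongrightarrow> av (x - c)) (P1_point av z)"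
        unfolding tendsto_iff dist_real_def
      proof (intro allI impI)
        fix e :: real assume "e > 0"
        from near[OF this] show "\<forall>\<^sub>F w in P1_point av z. \<bar>av (the w - c) - av (x - c)\<bar> < e"
        proof eventually_elim
          case (elim w)
          then obtain y where "w = Some y" "av (x - y) < e" by blast
          then show ?case
            using av_triangle[of x c y] av_triangle[of y c x] av_diff_commute[of x y] by auto
              (use av_nonneg[of "x - c"] av_nonneg[of "y - c"] \<open>e > 0\<close> in linarith)
        qed
      qed
      then have "((\<lambda>w. ereal (av (the w - c))) \<longlongrightarrow> ereal (av (x - c))) (P1_point av z)"
        by simp
      moreover have "\<forall>\<^sub>F w in P1_point av z. ereal (av (the w - c)) = P1_absdiff av c w"
        using near[of 1] by (auto elim!: eventually_mono)
      ultimately have "(P1_absdiff av c \<longlongrightarrow> ereal (av (x - c))) (P1_point av z)"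
        by (rule Lim_transform_eventually)
      then show ?thesis using Some by simp
    qed
  qed
  show "tree_filter av (P1_embed av z) \<le> P1_point av z"
  proof (rule filter_leI)
    fix P assume "eventually P (P1_point av z)"
    then obtain e where e: "e > 0" "\<And>w. P1_dist av z w < e \<Longrightarrow> P w"
      by (auto simp: eventually_P1_point)
    show "eventually P (tree_filter av (P1_embed av z))"
    proof (cases z)
      case None
      have "\<forall>\<^sub>F w in tree_filter av (P1_embed av z). ereal (1 / e) < P1_absdiff av 0 w"
        using None by (intro order_tendstoD(1)[OF tree_filter_tendsto]) (simp add: PK_absdiff_P1_embed)
      then show ?thesis
      proof eventually_elim
        case (elim w)
        have "P1_dist av z w < e"
        proof (cases w)
          case (Some y)
          then have "1 / e < max (av y) 1" using elim by simp
          then show ?thesis using None Some e(1) by (simp add: P1_dist_simps field_simps)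
        qed (use None e in \<open>simp add: P1_dist_simps\<close>)
        then show ?case by (rule e)
      qed
    next
      case (Some x)
      have "\<forall>\<^sub>F w in tree_filter av (P1_embed av z). P1_absdiff av x w < ereal e"
        using Some e(1) by (intro order_tendstoD(2)[OF tree_filter_tendsto]) (simp add: PK_absdiff_P1_embed)
      then show ?thesis
      proof eventually_elim
        case (elim w)
        then obtain y where y: "w = Some y" "av (y - x) < e" by (cases w) auto
        have "1 * 1 \<le> max (av x) 1 * max (av y) 1" by (intro mult_mono) auto
        then have "P1_dist av z w \<le> av (x - y) / 1"
          unfolding Some y P1_dist_simps by (intro divide_left_mono) (auto simp: av_nonneg)
        then show ?case using y av_diff_commute[of x y] by (intro e) simp
      qed
    qed
  qed
qed

lemma P1_point_in_Phat: "P1_point av z \<in> Phat av"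
  by (simp add: P1_point_eq_tree_filter tree_filter_in_Phat P1_embed_in_PK)

lemma filter_mem_P1_point_imp: "filter_mem Y (P1_point av z) \<Longrightarrow> z \<in> Y"
  using Metric_space.zero[OF Metric_space_P1, of z z]
  by (auto simp: filter_mem_def eventually_P1_point)

lemma open_affinoid_mem_P1_point:
  assumes "open_affinoid av Y" "z \<in> Y"
  shows "filter_mem Y (P1_point av z)"
proof -
  obtain \<B> where \<B>: "finite \<B>" "\<forall>B\<in>\<B>. P1_open_ball av B" "Y = \<Inter>\<B>"
    using assms(1) by (auto simp: open_affinoid_def)
  have "filter_mem B (P1_point av z)" if "B \<in> \<B>" for B
  proof -
    have "P1_open_ball av B" "z \<in> B" using \<B> assms(2) that by auto
    then show ?thesis
      unfolding P1_point_eq_tree_filter P1_open_ball_iff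
      by (auto simp: tree_filter_less_iff tree_filter_greater_iff P1_embed_in_PK PK_absdiff_P1_embed)
  qed
  then show ?thesis using \<B> by (simp add: filter_mem_Inter)
qed


section \<open>Closures of balls\<close>

lemma Phat_E:
  assumes "F \<in> Phat av"
  obtains p where "p \<in> PK av" "F = tree_filter av p"
  using assms bij_betw_imp_surj_on[OF bij_betw_tree_filter] by blast

text \<open>Between the limit value of \<open>|z - a|\<close> and the radius there is room for two values \<open>s < r\<close>; a set
  small for the cover of the line by \<open>|z - a| < r\<close> and \<open>|z - a| > s\<close> that belongs to the filter must be
  contained in the ball.\<close>

lemma openin_hat:
  assumes B: "P1_open_ball av B \<or> P1_irrational_ball av B"
  shows "openin (Phat_topology av) (hat av B)"
  unfolding openin_Phat_topology
proof (intro conjI ballI)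
  show "hat av B \<subseteq> Phat av" by (auto simp: hat_def)
  fix F assume F: "F \<in> hat av B"
  then obtain p where p: "p \<in> PK av" "F = tree_filter av p" by (auto simp: hat_def elim: Phat_E)
  have FB: "filter_mem B (tree_filter av p)" using F p by (simp add: hat_def)
  obtain a s r where sr: "s \<in> value_group av" "r \<in> value_group av" "s < r"
    and alt: "({z. P1_absdiff av a z < ereal r} \<subseteq> B \<and> PK_absdiff av a p < ereal s) \<or>
         ({z. ereal s < P1_absdiff av a z} \<subseteq> B \<and> ereal r < PK_absdiff av a p)"
    using B
  proof (cases rule: open_or_irrational_ball_cases)
    case (1 a t)
    then have "PK_absdiff av a p < ereal t" using FB tree_filter_less_iff[OF p(1)] by simp
    then obtain x where x: "PK_absdiff av a p = ereal x" "0 \<le> x" "x < t"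
      using PK_absdiff_nonneg[OF p(1), of a] by (cases "PK_absdiff av a p") auto
    obtain r where r: "r \<in> value_group av" "x < r" "r < t" using value_group_dense x by blast
    obtain s where s: "s \<in> value_group av" "x < s" "s < r" using value_group_dense x r by blast
    have "{z. P1_absdiff av a z < ereal r} \<subseteq> B"
      unfolding 1(2) using r(3) by (auto intro: less_trans[of _ "ereal r"])
    then show ?thesis using that[OF s(1) r(1) s(3), of a] x(1) s(2) by simp
  next
    case (2 a t)
    then have "ereal t < PK_absdiff av a p" using FB tree_filter_greater_iff[OF p(1)] by simp
    then obtain u where u: "ereal t < ereal u" "ereal u < PK_absdiff av a p" using ereal_dense2 by blast
    obtain r where r: "r \<in> value_group av" "t < r" "r < u" using value_group_dense[of t u] 2(1) u by auto
    obtain s where s: "s \<in> value_group av" "t < s" "s < r" using value_group_dense[of t r] 2(1) r by auto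
    have "ereal r < PK_absdiff av a p" using r u by (auto intro: less_trans[of _ "ereal u"])
    moreover have "{z. ereal s < P1_absdiff av a z} \<subseteq> B"
      using 2(2) s by (auto intro: less_trans[of _ "ereal s"])
    ultimately show ?thesis using that[OF s(1) r(1) s(3), of a] by blast
  qed
  define C where "C = {{z. P1_absdiff av a z < ereal r}, {z. ereal s < P1_absdiff av a z}}"
  define E where "E = common_small av (cover_entourage C)"
  have "cover_entourage C \<in> P1_uniformity av"
    using two_ball_cover[OF sr] by (auto simp: P1_uniformity_def C_def)
  then have "E \<in> Phat_uniformity av"
    by (auto simp: Phat_uniformity_def E_def common_small_def)
  moreover have "G \<in> hat av B" if G: "(F, G) \<in> E" for G
  proof -
    obtain Y where Y: "filter_mem Y F" "filter_mem Y G" "Y \<times> Y \<subseteq> cover_entourage C" "G \<in> Phat av"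
      using G unfolding E_def common_small_def by blast
    have "Y \<subseteq> {z. P1_absdiff av a z < ereal r} \<or> Y \<subseteq> {z. ereal s < P1_absdiff av a z}"
      using Y(3) unfolding C_def by (rule small_for_two_sets)
    moreover have "\<not> Y \<subseteq> {z. ereal s < P1_absdiff av a z}" if "PK_absdiff av a p < ereal s"
      using filter_mem_mono[OF Y(1)] tree_filter_greater_iff[OF p(1)] that
      unfolding p(2) by (meson less_asym)
    moreover have "\<not> Y \<subseteq> {z. P1_absdiff av a z < ereal r}" if "ereal r < PK_absdiff av a p"
      using filter_mem_mono[OF Y(1)] tree_filter_less_iff[OF p(1)] that
      unfolding p(2) by (meson less_asym)
    ultimately have "Y \<subseteq> B" using alt by blast
    then show ?thesis using filter_mem_mono[OF Y(2)] Y(4) by (simp add: hat_def)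
  qed
  ultimately show "\<exists>E\<in>Phat_uniformity av. E `` {F} \<subseteq> hat av B" by blast
qed

lemma topspace_Phat: "topspace (Phat_topology av) = Phat av"
proof (rule antisym)
  show "topspace (Phat_topology av) \<subseteq> Phat av"
    using openin_topspace[of "Phat_topology av"] unfolding openin_Phat_topology by (rule conjunct1)
  have "{UNIV} \<in> affinoid_covers av"
    by (auto simp: affinoid_covers_def open_affinoid_def intro: exI[of _ "{}"])
  then have "UNIV \<in> P1_uniformity av" by (auto simp: P1_uniformity_def)
  then have "Phat av \<times> Phat av \<in> Phat_uniformity av"
    by (auto simp: Phat_uniformity_def common_small_def)
  then have "openin (Phat_topology av) (Phat av)"
    by (auto simp: openin_Phat_topology)
  then show "Phat av \<subseteq> topspace (Phat_topology av)" by (rule openin_subset)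
qed

text \<open>A minimal Cauchy filter to which \<open>- B\<close> does not belong has arbitrarily small members meeting \<open>B\<close>,
  namely open affinoids, and these are neighbourhoods of their points.\<close>

lemma P1_closure_eq:
  assumes B: "P1_closed_ball av B \<or> P1_irrational_ball av B"
  shows "P1_closure av B = Phat av - hat av (- B)"
proof (intro equalityI subsetI)
  fix F assume F: "F \<in> P1_closure av B"
  have "P1_open_ball av (- B) \<or> P1_irrational_ball av (- B)"
    using B by (metis P1_closed_ball_Compl P1_irrational_ball_Compl double_compl)
  then have op: "openin (Phat_topology av) (hat av (- B))" by (rule openin_hat)
  have "F \<notin> hat av (- B)"
  proof
    assume "F \<in> hat av (- B)"
    then obtain z where "z \<in> B" "P1_point av z \<in> hat av (- B)"
      using F op unfolding P1_closure_def in_closure_of by blast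
    then show False using filter_mem_P1_point_imp[of "- B" z] by (auto simp: hat_def)
  qed
  then show "F \<in> Phat av - hat av (- B)"
    using F by (simp add: P1_closure_def in_closure_of topspace_Phat)
next
  fix F assume F: "F \<in> Phat av - hat av (- B)"
  then obtain p where p: "p \<in> PK av" "F = tree_filter av p" by (auto elim: Phat_E)
  show "F \<in> P1_closure av B"
    unfolding P1_closure_def in_closure_of topspace_Phat
  proof (intro conjI allI impI)
    show "F \<in> Phat av" using F by blast
    fix T assume T: "F \<in> T \<and> openin (Phat_topology av) T"
    then obtain E where E: "E \<in> Phat_uniformity av" "E `` {F} \<subseteq> T"
      unfolding openin_Phat_topology by blast
    then obtain V C where V: "common_small av V \<subseteq> E" and C: "C \<in> affinoid_covers av" "cover_entourage C \<subseteq> V"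
      by (auto simp: Phat_uniformity_def P1_uniformity_def)
    obtain Y where Y: "Y \<in> C" "filter_mem Y F"
      using affinoid_cover_Lebesgue_number[OF C(1)] p PK_dist_self[OF p(1)] by metis
    have "\<not> Y \<subseteq> - B" using F filter_mem_mono[OF Y(2)] by (auto simp: hat_def)
    then obtain z where z: "z \<in> Y" "z \<in> B" by blast
    have "filter_mem Y (P1_point av z)"
      using open_affinoid_mem_P1_point z(1) C(1) Y(1) by (auto simp: affinoid_covers_def)
    moreover have "Y \<times> Y \<subseteq> V" using C(2) Y(1) by (auto simp: cover_entourage_def)
    ultimately have "(F, P1_point av z) \<in> E"
      using V Y(2) F P1_point_in_Phat by (auto simp: common_small_def)
    then show "\<exists>y. y \<in> P1_point av ` B \<and> y \<in> T" using E(2) z(2) by blast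
  qed
qed


section \<open>The ball of a filter\<close>

text \<open>The balls in the filter are those with \<open>sup{c, S} < r\<close>, and possibly closed ones with
  \<open>sup{c, S} = r\<close>; the latter change nothing, since balls \<open>|z - c| < r\<close> with \<open>r\<close> slightly larger cut
  out the same intersection.\<close>

lemma ball_of_tree_filter:
  assumes S: "S \<in> AK av"
  shows "ball_of_filter av (tree_filter av (Some S)) = {w. \<forall>c. av (w - c) \<le> AK_sup av (K_embed av c) S}"
proof -
  have p: "Some S \<in> PK av" using S by (simp add: PK_def)
  have lt: "filter_mem (Some ` {z. av (z - c) < r}) (tree_filter av (Some S)) \<longleftrightarrow>
      AK_sup av (K_embed av c) S < r" for c r
    using tree_filter_less_iff[OF p] by (simp add: ball_eq_absdiff)
  have le: "AK_sup av (K_embed av c) S \<le> r"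
    if "filter_mem (Some ` {z. av (z - c) \<le> r}) (tree_filter av (Some S))" for c r
  proof (rule field_le_epsilon)
    fix e :: real assume "e > 0"
    then have "Some ` {z. av (z - c) \<le> r} \<subseteq> Some ` {z. av (z - c) < r + e}" by auto
    from filter_mem_mono[OF that this] show "AK_sup av (K_embed av c) S \<le> r + e"
      by (simp add: lt)
  qed
  show ?thesis
  proof (intro equalityI subsetI CollectI allI)
    fix w c assume w: "w \<in> ball_of_filter av (tree_filter av (Some S))"
    show "av (w - c) \<le> AK_sup av (K_embed av c) S"
    proof (rule ccontr)
      assume "\<not> ?thesis"
      then obtain r where r: "r \<in> value_group av" "AK_sup av (K_embed av c) S < r" "r < av (w - c)"
        using value_group_dense[of "AK_sup av (K_embed av c) S" "av (w - c)"]
          AK_sup_nonneg[OF K_embed_in_AK S, of c] by auto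
      have "K_ball av {z. av (z - c) < r}"
        using r(1) unfolding K_ball_def K_open_ball_def by blast
      moreover have "filter_mem (Some ` {z. av (z - c) < r}) (tree_filter av (Some S))"
        using r(2) by (simp only: lt)
      ultimately have "w \<in> {z. av (z - c) < r}"
        using w unfolding ball_of_filter_def by blast
      then show False using r(3) by simp
    qed
  next
    fix w assume w: "w \<in> {w. \<forall>c. av (w - c) \<le> AK_sup av (K_embed av c) S}"
    have "w \<in> B" if B: "K_ball av B" "filter_mem (Some ` B) (tree_filter av (Some S))" for B
    proof -
      obtain c r where "B = {z. av (z - c) < r} \<or> B = {z. av (z - c) \<le> r}"
        using B(1) unfolding K_ball_def K_open_ball_def K_closed_ball_def K_irrational_ball_def by blast
      then show ?thesis using w B(2) lt[of c r] le[of c r] by (auto intro: order_trans le_less_trans)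
    qed
    then show "w \<in> ball_of_filter av (tree_filter av (Some S))" by (simp add: ball_of_filter_def)
  qed
qed

lemma disc_mem_iff_distances:
  assumes "0 \<le> r"
  shows "(\<forall>c. av (w - c) \<le> max r (av (c - x))) \<longleftrightarrow> av (w - x) \<le> r"
proof
  assume "\<forall>c. av (w - c) \<le> max r (av (c - x))"
  then have "av (w - x) \<le> max r (av (x - x))" by blast
  then show "av (w - x) \<le> r" using assms by simp
next
  assume w: "av (w - x) \<le> r"
  show "\<forall>c. av (w - c) \<le> max r (av (c - x))"
  proof
    fix c
    show "av (w - c) \<le> max r (av (c - x))"
      using w av_triangle[of w c x] av_diff_commute[of x c] by linarith
  qed
qed

lemma closed_disc_radius_unique:
  assumes "0 < r" "0 \<le> r'" "{w. av (w - x) \<le> r'} = {w. av (w - x) \<le> r}"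
  shows "r' = r"
proof -
  have "\<not> s < t" if st: "0 \<le> s" "{w. av (w - x) \<le> s} = {w. av (w - x) \<le> t}" for s t
  proof
    assume "s < t"
    then obtain u where u: "s < av u" "av u < t"
      using value_group_dense[OF st(1), of t] by (auto simp: value_group_iff)
    have "x + u \<in> {w. av (w - x) \<le> t}" using u by simp
    then have "x + u \<in> {w. av (w - x) \<le> s}" using st(2) by simp
    then show False using u by simp
  qed
  from this[of r' r] this[of r r'] show ?thesis using assms by auto
qed

text \<open>If the ball of the filter of \<open>T\<close> is the disc \<open>|w - x| \<le> r\<close>, then \<open>|x - c| \<le> sup{c, T}\<close> for all \<open>c\<close>.
  Hence \<open>T\<close> is a disc with centre \<open>x\<close>, and density of the value group determines its radius.\<close>

lemma iota_eq_tree_filter: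
  assumes S: "S \<in> AKR av - range (\<lambda>x. disc av x 0)"
  shows "iota av S = tree_filter av (Some (AK_embed av S))"
proof -
  obtain x r where Sx: "0 \<le> r" "S = disc av x r" using S by (auto elim: AKR_cases)
  then have r: "0 < r" using S by (cases "r = 0") auto
  define S' where "S' = AK_embed av S"
  have S': "S' \<in> AK av" using S by (simp add: S'_def AK_embed_in_AK)
  then have p: "Some S' \<in> PK av" by (simp add: PK_def)
  have sup: "AK_sup av (K_embed av c) S' = max r (av (c - x))" for c
    unfolding S'_def Sx(2) using Sx(1) by (rule AK_sup_K_embed_disc)
  have ball: "ball_of_filter av (tree_filter av (Some S')) = AKR_ball av S"
  proof -
    have "{w. \<forall>c. av (w - c) \<le> max r (av (c - x))} = {w. av (w - x) \<le> r}"
      by (simp add: disc_mem_iff_distances[OF Sx(1)])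
    then show ?thesis
      unfolding ball_of_tree_filter[OF S'] sup Sx(2) AKR_ball_disc[OF Sx(1)] by simp
  qed
  show ?thesis
    unfolding iota_def S'_def[symmetric]
  proof (rule the_equality)
    have "\<not> P1_convergent av (tree_filter av (Some S'))"
    proof
      assume "P1_convergent av (tree_filter av (Some S'))"
      then obtain z where "tree_filter av (Some S') \<le> tree_filter av (P1_embed av z)"
        unfolding P1_convergent_def P1_point_def[symmetric] P1_point_eq_tree_filter by blast
      then have z: "Some S' = P1_embed av z"
        by (rule tree_filter_le_imp_eq[OF p P1_embed_in_PK])
      then obtain y where "S' = K_embed av y" by (cases z) (auto simp: P1_embed_def)
      then have "max r (av (y - x)) = 0" using sup[of y] by (simp add: AK_sup_K_embed)
      then show False using r by simp
    qed
    then show "tree_filter av (Some S') \<in> Phat av \<and> \<not> P1_convergent av (tree_filter av (Some S'))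
        \<and> ball_of_filter av (tree_filter av (Some S')) = AKR_ball av S"
      using ball tree_filter_in_Phat[OF p] by blast
  next
    fix F assume F: "F \<in> Phat av \<and> \<not> P1_convergent av F \<and> ball_of_filter av F = AKR_ball av S"
    then obtain q where q: "q \<in> PK av" "F = tree_filter av q" by (auto elim: Phat_E)
    have "q \<noteq> None"
    proof
      assume "q = None"
      then have "F \<le> nhdsin (P1_topology av) None"
        using q P1_point_eq_tree_filter[of None] by (simp add: P1_embed_def P1_point_def)
      then show False using F by (auto simp: P1_convergent_def)
    qed
    then obtain T where T: "T \<in> AK av" "q = Some T" using q(1) by (auto elim: PK_cases)
    define \<rho> where "\<rho> = AK_sup av (K_embed av x) T"
    have \<rho>: "0 \<le> \<rho>" by (simp add: \<rho>_def AK_sup_nonneg K_embed_in_AK T)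
    have ballT: "{w. \<forall>c. av (w - c) \<le> AK_sup av (K_embed av c) T} = {w. av (w - x) \<le> r}"
      using F ball_of_tree_filter[OF T(1)] AKR_ball_disc[OF Sx(1)] by (simp add: q T Sx(2))
    have "x \<in> {w. av (w - x) \<le> r}" using r by simp
    then have "av (x - c) \<le> AK_sup av (K_embed av c) T" for c
      unfolding ballT[symmetric] by blast
    then have supT: "AK_sup av (K_embed av c) T = max \<rho> (av (c - x))" for c
      using AK_sup_K_ultra(1)[OF T(1), of c x] AK_sup_K_ultra(1)[OF T(1), of x c] av_diff_commute[of c x]
      by (auto simp: \<rho>_def max_def intro: antisym split: if_splits)
    have "{w. av (w - x) \<le> \<rho>} = {w. av (w - x) \<le> r}"
      using ballT unfolding supT by (simp add: disc_mem_iff_distances[OF \<rho>])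
    then have "\<rho> = r" using closed_disc_radius_unique[OF r \<rho>] by simp
    then have "T = S'" using supT sup by (intro AK_eq_if_sup_K_eq T S') simp
    then show "F = tree_filter av (Some S')" using q T by simp
  qed
qed

end

section \<open>The extension of \<open>\<iota>\<close> to the complete tree\<close>

theorem mainTheorem1:
  fixes av :: "'k::field \<Rightarrow> real"
  assumes "ultrametric_field av"
  shows "\<exists>\<iota> :: 'k tree_point option \<Rightarrow> 'k option filter.
      (\<forall>S\<in>AKR av - range (\<lambda>x. disc av x 0). \<iota> (Some (AK_embed av S)) = iota av S)
    \<and> uniformly_continuous_into (PK av) (PK_dist av) (Phat_uniformity av) \<iota>
    \<and> bij_betw \<iota> (PK av) (Phat av)
    \<and> (\<forall>B. P1_open_ball av B \<or> P1_irrational_ball av B \<longrightarrow> \<iota> ` corr_open_ball av B = hat av B)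
    \<and> (\<forall>B. P1_closed_ball av B \<or> P1_irrational_ball av B \<longrightarrow> \<iota> ` corr_closed_ball av B = P1_closure av B)"
proof -
  interpret ultrametric_field av by (rule assms)
  have surj: "tree_filter av ` PK av = Phat av"
    using bij_betw_tree_filter by (rule bij_betw_imp_surj_on)
  have image: "tree_filter av ` {p \<in> PK av. Q (tree_filter av p)} = {F \<in> Phat av. Q F}" for Q
    unfolding surj[symmetric] by blast
  have "tree_filter av ` corr_open_ball av B = hat av B"
    if "P1_open_ball av B \<or> P1_irrational_ball av B" for B
    unfolding corr_open_ball_eq[OF that] image hat_def by simp
  moreover have "tree_filter av ` corr_closed_ball av B = P1_closure av B"
    if "P1_closed_ball av B \<or> P1_irrational_ball av B" for B
    unfolding corr_closed_ball_eq[OF that] P1_closure_eq[OF that] image[of "\<lambda>F. \<not> filter_mem (- B) F"]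
    by (auto simp: hat_def)
  ultimately show ?thesis
    using iota_eq_tree_filter uniformly_continuous_tree_filter bij_betw_tree_filter
    by (intro exI[of _ "tree_filter av"]) simp
qed

end
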